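(* Fix parameters $\alpha_1,\dots,\alpha_r$, $\beta_1,\dots,\beta_t$, $\gamma_1,\dots,\gamma_s$ and let $\Gamma_1,\Gamma_2,\Gamma_3,\Gamma_4$ be the bicirculant graphs over $\mathbb{Z}_n$ described in the context, for those $n$ for which the standing assumptions there hold. Let $k_1$ (resp. $k_2$) be the number of odd (resp. even) numbers in $\{\alpha_1,\dots,\alpha_r\}$, let $m_1$ (resp. $m_2$) be the number of odd (resp. even) numbers in $\{\beta_1,\dots,\beta_t\}$, and let $h_1$ (resp. $h_2$) be the number of odd (resp. even) numbers in $\{\gamma_1,\dots,\gamma_s\}$. Let $q_1,q_2,q_3,q_4$ be the square-free parts of $(4k_1+s)(4m_1+s)-(h_2-h_1)^2$, $(4k_1+s+2)(4m_1+s)-(h_2-h_1)^2$, $(4k_1+s)(4m_1+s+2)-(h_2-h_1)^2$, $(4k_1+s+2)(4m_1+s+2)-(h_2-h_1)^2$, respectively. Then: (1) there exist integer sequences $a_1(n)$ and $b_1(n)$ such that $\tau(\Gamma_1)=ns\,a_1(n)^2$ if $n$ is odd, and $\tau(\Gamma_1)=nsq_1\,b_1(n)^2$ if $n$ is even; (2) there exist integer sequences $a_2(n)$ and $b_2(n)$ such that $\tau(\Gamma_2)=\frac14nsq_2\,a_2(n)^2$ if $\frac n2$ is odd, and $\tau(\Gamma_2)=\frac14nsq_1\,b_2(n)^2$ if $\frac n2$ is even; (3) there exist integer sequences $a_3(n)$ and $b_3(n)$ such that $\tau(\Gamma_3)=\frac14nsq_3\,a_3(n)^2$ if $\frac n2$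 is odd, and $\tau(\Gamma_3)=\frac14nsq_1\,b_3(n)^2$ if $\frac n2$ is even; (4) there exist integer sequences $a_4(n)$ and $b_4(n)$ such that $\tau(\Gamma_4)=\frac14nsq_4\,a_4(n)^2$ if $\frac n2$ is odd, and $\tau(\Gamma_4)=\frac14nsq_1\,b_4(n)^2$ if $\frac n2$ is even.
   Context: $\tau(\Gamma)$ denotes the number of spanning trees of $\Gamma$. Any positive integer $u$ can be written uniquely as $u=v\rho^2$ with $v,\rho$ positive integers and $v$ square-free; $v$ is the square-free part of $u$. (Each $q_j$ is only needed in the cases where it occurs in the formulas; in those cases the integer whose square-free part is taken is positive.) For $R=-R\subseteq\mathbb{Z}_n\setminus\{0\}$, $T=-T\subseteq\mathbb{Z}_n\setminus\{0\}$, $S\subseteq\mathbb{Z}_n$, the bicirculant graph $BC(\mathbb{Z}_n;R,T,S)$ is the simple undirected graph with vertex set $\{h_0: h\in\mathbb{Z}_n\}\cup\{h_1:h\in\mathbb{Z}_n\}$ ($2n$ vertices) and edges $\{h_0,g_0\}$ for $g-h\in R$, $\{h_1,g_1\}$ for $g-h\in T$, and $\{h_0,g_1\}$ for $g-h\in S$. Parameters: integers $1\le\alpha_1<\cdots<\alpha_r<\frac n2$, $1\le\beta_1<\cdots<\beta_t<\frac n2$, $0\le\gamma_1<\cdots<\gamma_s\le n-1$ ($r,t\ge 0$, $s\ge1$). Put $R_0=\{\pm\alpha_1,\dots,\pm\alpha_r\}$, $T_0=\{\pm\beta_1,\dots,\pm\beta_t\}$, $S=\{\gamma_1,\dots,\gamma_s\}$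 in $\mathbb{Z}_n$. Then $\Gamma_1=BC(\mathbb{Z}_n;R_0,T_0,S)$, and, for $n$ even, $\Gamma_2=BC(\mathbb{Z}_n;R_0\cup\{\frac n2\},T_0,S)$, $\Gamma_3=BC(\mathbb{Z}_n;R_0,T_0\cup\{\frac n2\},S)$, $\Gamma_4=BC(\mathbb{Z}_n;R_0\cup\{\frac n2\},T_0\cup\{\frac n2\},S)$. Standing assumption (ensuring connectedness): at least one of the following holds: (a) $\gcd(n,\alpha_1,\dots,\alpha_r)=1$ and $s>0$; (b) $\gcd(n,\beta_1,\dots,\beta_t)=1$ and $s>0$; (c) the gcd of $n$ and all differences $\gamma_\ell-\gamma_m$ ($1\le m<\ell\le s$) is $1$. Also assumed throughout: with $\mathcal{A}(z)=2r+s-\sum_{j=1}^r(z^{\alpha_j}+z^{-\alpha_j})$, $\mathcal{B}(z)=2t+s-\sum_{j=1}^t(z^{\beta_j}+z^{-\beta_j})$, $\mathcal{C}(z)=\sum_{j=1}^s z^{\gamma_j}$, the Laurent polynomials $P_1=\mathcal{A}(z)\mathcal{B}(z)-\mathcal{C}(z^{-1})\mathcal{C}(z)$, $P_2=(\mathcal{A}(z)+2)\mathcal{B}(z)-\mathcal{C}(z^{-1})\mathcal{C}(z)$, $P_3=\mathcal{A}(z)(\mathcal{B}(z)+2)-\mathcal{C}(z^{-1})\mathcal{C}(z)$, $P_4=(\mathcal{A}(z)+2)(\mathcal{B}(z)+2)-\mathcal{C}(z^{-1})\mathcal{C}(z)$ (each invariant under $z\mapsto z^{-1}$) are nonzero and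 have the same degree, i.e. the same highest power of $z$ with nonzero coefficient. *)

theory Defs
  imports
    Complex_Main
    "HOL-Library.Poly_Mapping"
    "HOL-Computational_Algebra.Squarefree"
begin

text \<open>Simple undirected graphs are pairs of a vertex set and a set of two-element vertex sets.\<close>

type_synonym 'v graph = "'v set \<times> 'v set set"

definition graph_connected :: "'v graph \<Rightarrow> bool" where
  "graph_connected G \<longleftrightarrow> fst G \<noteq> {} \<and>
     (\<forall>u\<in>fst G. \<forall>v\<in>fst G. (u, v) \<in> {(x, y). {x, y} \<in> snd G}\<^sup>*)"

definition graph_cycle :: "'v graph \<Rightarrow> 'v list \<Rightarrow> bool" where
  "graph_cycle G c \<longleftrightarrow> 3 \<le> length c \<and> distinct c \<and>
     (\<forall>i<length c. {c ! i, c ! (Suc i mod length c)} \<in> snd G)"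

definition graph_tree :: "'v graph \<Rightarrow> bool" where
  "graph_tree G \<longleftrightarrow> graph_connected G \<and> (\<nexists>c. graph_cycle G c)"

definition spanning_tree_count :: "'v graph \<Rightarrow> nat" ("\<tau>") where
  "\<tau> G = card {F. F \<subseteq> snd G \<and> graph_tree (fst G, F)}"

text \<open>Elements of \<open>\<int>\<^sub>n\<close> are represented by the residues \<open>0, \<dots>, n - 1\<close>; the vertex
  \<open>h\<^sub>i\<close> is the pair \<open>(h, i)\<close> with \<open>i \<in> {0, 1}\<close>.\<close>

definition BC :: "nat \<Rightarrow> int set \<Rightarrow> int set \<Rightarrow> int set \<Rightarrow> (int \<times> nat) graph" where
  "BC n R T S =
     ({0..<int n} \<times> {0, 1},
      {{(h, 0), (g, 0)} | h g. h \<in> {0..<int n} \<and> g \<in> {0..<int n} \<and> (g - h) mod int n \<in> R} \<union>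
      {{(h, 1), (g, 1)} | h g. h \<in> {0..<int n} \<and> g \<in> {0..<int n} \<and> (g - h) mod int n \<in> T} \<union>
      {{(h, 0), (g, 1)} | h g. h \<in> {0..<int n} \<and> g \<in> {0..<int n} \<and> (g - h) mod int n \<in> S})"

definition pm_residues :: "nat \<Rightarrow> nat list \<Rightarrow> int set" where
  "pm_residues n \<alpha> = (\<Union>a\<in>set \<alpha>. {int a mod int n, (- int a) mod int n})"

definition residues_of :: "nat \<Rightarrow> nat list \<Rightarrow> int set" where
  "residues_of n \<gamma> = (\<lambda>c. int c mod int n) ` set \<gamma>"

text \<open>\<open>\<Gamma>\<^sub>2\<close>, \<open>\<Gamma>\<^sub>3\<close> and \<open>\<Gamma>\<^sub>4\<close> are meaningful only for even \<open>n\<close>.\<close>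

definition \<Gamma>\<^sub>1 :: "nat list \<Rightarrow> nat list \<Rightarrow> nat list \<Rightarrow> nat \<Rightarrow> (int \<times> nat) graph" where
  "\<Gamma>\<^sub>1 \<alpha> \<beta> \<gamma> n = BC n (pm_residues n \<alpha>) (pm_residues n \<beta>) (residues_of n \<gamma>)"

definition \<Gamma>\<^sub>2 :: "nat list \<Rightarrow> nat list \<Rightarrow> nat list \<Rightarrow> nat \<Rightarrow> (int \<times> nat) graph" where
  "\<Gamma>\<^sub>2 \<alpha> \<beta> \<gamma> n =
     BC n (pm_residues n \<alpha> \<union> {int n div 2}) (pm_residues n \<beta>) (residues_of n \<gamma>)"

definition \<Gamma>\<^sub>3 :: "nat list \<Rightarrow> nat list \<Rightarrow> nat list \<Rightarrow> nat \<Rightarrow> (int \<times> nat) graph" where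
  "\<Gamma>\<^sub>3 \<alpha> \<beta> \<gamma> n =
     BC n (pm_residues n \<alpha>) (pm_residues n \<beta> \<union> {int n div 2}) (residues_of n \<gamma>)"

definition \<Gamma>\<^sub>4 :: "nat list \<Rightarrow> nat list \<Rightarrow> nat list \<Rightarrow> nat \<Rightarrow> (int \<times> nat) graph" where
  "\<Gamma>\<^sub>4 \<alpha> \<beta> \<gamma> n =
     BC n (pm_residues n \<alpha> \<union> {int n div 2}) (pm_residues n \<beta> \<union> {int n div 2})
       (residues_of n \<gamma>)"

text \<open>The conditions on the parameters that involve \<open>n\<close>: their ranges, and the gcd
  conditions that make the bicirculant graphs connected.\<close>

definition admissible :: "nat list \<Rightarrow> nat list \<Rightarrow> nat list \<Rightarrow> nat \<Rightarrow> bool" where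
  "admissible \<alpha> \<beta> \<gamma> n \<longleftrightarrow>
     (\<forall>a\<in>set \<alpha>. 2 * a < n) \<and> (\<forall>b\<in>set \<beta>. 2 * b < n) \<and> (\<forall>c\<in>set \<gamma>. c < n) \<and>
     ((Gcd (insert n (set \<alpha>)) = 1 \<and> length \<gamma> > 0) \<or>
      (Gcd (insert n (set \<beta>)) = 1 \<and> length \<gamma> > 0) \<or>
      Gcd (insert (int n) {int (\<gamma> ! l) - int (\<gamma> ! m) | l m. m < l \<and> l < length \<gamma>}) = 1)"

text \<open>Integer Laurent polynomials are finitely supported maps from exponents in \<open>\<int>\<close> to
  coefficients, multiplied by convolution.\<close>

type_synonym laurent = "int \<Rightarrow>\<^sub>0 int"

definition zpow :: "int \<Rightarrow> laurent" where
  "zpow k = Poly_Mapping.single k 1"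

definition laurent_degree :: "laurent \<Rightarrow> int" where
  "laurent_degree P = Max (Poly_Mapping.keys P)"

text \<open>\<open>lapA \<alpha> s\<close> is \<open>\<A>(z)\<close>, \<open>lapA \<beta> s\<close> is \<open>\<B>(z)\<close>, and \<open>lapC e \<gamma>\<close> is \<open>\<C>(z\<^sup>e)\<close>.\<close>

definition lapA :: "nat list \<Rightarrow> nat \<Rightarrow> laurent" where
  "lapA \<alpha> s = of_nat (2 * length \<alpha> + s) - (\<Sum>a\<in>set \<alpha>. zpow (int a) + zpow (- int a))"

definition lapC :: "int \<Rightarrow> nat list \<Rightarrow> laurent" where
  "lapC e \<gamma> = (\<Sum>c\<in>set \<gamma>. zpow (e * int c))"

definition P\<^sub>1 :: "nat list \<Rightarrow> nat list \<Rightarrow> nat list \<Rightarrow> laurent" where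
  "P\<^sub>1 \<alpha> \<beta> \<gamma> = lapA \<alpha> (length \<gamma>) * lapA \<beta> (length \<gamma>) - lapC (-1) \<gamma> * lapC 1 \<gamma>"

definition P\<^sub>2 :: "nat list \<Rightarrow> nat list \<Rightarrow> nat list \<Rightarrow> laurent" where
  "P\<^sub>2 \<alpha> \<beta> \<gamma> = (lapA \<alpha> (length \<gamma>) + 2) * lapA \<beta> (length \<gamma>) - lapC (-1) \<gamma> * lapC 1 \<gamma>"

definition P\<^sub>3 :: "nat list \<Rightarrow> nat list \<Rightarrow> nat list \<Rightarrow> laurent" where
  "P\<^sub>3 \<alpha> \<beta> \<gamma> = lapA \<alpha> (length \<gamma>) * (lapA \<beta> (length \<gamma>) + 2) - lapC (-1) \<gamma> * lapC 1 \<gamma>"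

definition P\<^sub>4 :: "nat list \<Rightarrow> nat list \<Rightarrow> nat list \<Rightarrow> laurent" where
  "P\<^sub>4 \<alpha> \<beta> \<gamma> = (lapA \<alpha> (length \<gamma>) + 2) * (lapA \<beta> (length \<gamma>) + 2) - lapC (-1) \<gamma> * lapC 1 \<gamma>"

definition odd_count :: "nat list \<Rightarrow> int" where
  "odd_count \<alpha> = int (card {a \<in> set \<alpha>. odd a})"

definition even_count :: "nat list \<Rightarrow> int" where
  "even_count \<alpha> = int (card {a \<in> set \<alpha>. even a})"

end

(* The Fourier basis block-diagonalises L + J, where L is the Laplacian and J the
   all-ones matrix, so the matrix-tree theorem gives n * tau = s * (product over 0 < j < n of F(w^j)),
   where w is a primitive n-th root of unity and F is P_1 for even j and one of P_1, ..., P_4 for odd j.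
   Each P_i is p_i(z + 1/z) with an integer polynomial p_i, hence F(w^j) = F(w^(n-j)) and the product is
   a square up to the factor with w^j = -1. The half products are integers, being products of an
   integer polynomial over all roots of a monic integer polynomial of Chebyshev type. Since p_1(2) = 0,
   p_1 = (2 - x) p with integral p; over half a period the factors 2 - w^j - w^(-j) multiply to n or n/2, which gives
   the divisibility by n, and 4 | p_1(-2) makes the square root integral after extracting the
   square-free part. *)
theory Submission
  imports Defs "HOL-Library.FuncSet" "Jordan_Normal_Form.Char_Poly"
begin

section \<open>Spanning trees as acyclic parent maps\<close>

text \<open>Deleting a row and a column of \<open>L\<close> would destroy the circulant blocks,
  whereas \<open>J\<close> is block circulant itself and lives in the Fourier mode j = 0 only. There
  the 2x2 determinant becomes 4ns, and against the (2n)^2 of the matrix-tree theorem for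
  \<open>L + J\<close> this leaves the factors n and s. The obstacle in (2) to (4) is that only p_1
  vanishes at 2. The factor 2 - x is therefore available only at even j, that is, at the (n/2)-th
  roots of unity, and the odd j contribute a mere integer. Divisibility drops from n to n/2, which
  is the origin of 1/4. The index n/2, where w^j = -1, has the parity of n/2, and this decides
  between p_1(-2) and p_i(-2). For i > 1 the value p_i(-2) need not be divisible by 4, but it is met
  only when n/2 is odd, and then the even half product carries the full n/2 instead of n/4.\<close>

text \<open>The decreasing potential \<open>d\<close> encodes that iterating \<open>f\<close> from any vertex reaches the root.\<close>

definition parent_maps :: "'v graph \<Rightarrow> 'v \<Rightarrow> ('v \<Rightarrow> 'v) set" where
  "parent_maps G r = {f \<in> (\<Pi>\<^sub>E v\<in>fst G - {r}. {u\<in>fst G. {v, u} \<in> snd G}).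
     \<exists>d::'v \<Rightarrow> nat. \<forall>v\<in>fst G - {r}. d (f v) < d v}"

definition parent_edges :: "'v set \<Rightarrow> 'v \<Rightarrow> ('v \<Rightarrow> 'v) \<Rightarrow> 'v set set" where
  "parent_edges V r f = (\<lambda>v. {v, f v}) ` (V - {r})"

lemma connected_parent_edges:
  fixes d :: "'v \<Rightarrow> nat"
  assumes r: "r \<in> V" and f: "\<And>v. v \<in> V - {r} \<Longrightarrow> f v \<in> V"
    and d: "\<And>v. v \<in> V - {r} \<Longrightarrow> d (f v) < d v"
  shows "graph_connected (V, parent_edges V r f)"
proof -
  define R where "R = {(x, y). {x, y} \<in> parent_edges V r f}"
  have to_root: "v \<in> V \<Longrightarrow> (v, r) \<in> R\<^sup>*" for v
  proof (induction "d v" arbitrary: v rule: less_induct)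
    case less
    show ?case
    proof (cases "v = r")
      case False
      then have v: "v \<in> V - {r}" using less.prems by auto
      then have "(v, f v) \<in> R" unfolding R_def parent_edges_def by auto
      moreover have "(f v, r) \<in> R\<^sup>*" using less.hyps[OF d[OF v] f[OF v]] .
      ultimately show ?thesis by (rule converse_rtrancl_into_rtrancl)
    qed simp
  qed
  have "sym R" unfolding R_def sym_def by (auto simp: insert_commute)
  then have "sym (R\<^sup>*)" by (rule sym_rtrancl)
  then have "(u, v) \<in> R\<^sup>*" if "u \<in> V" "v \<in> V" for u v
    using to_root[OF that(1)] to_root[OF that(2)] by (meson rtrancl_trans symD)
  then show ?thesis using r unfolding graph_connected_def R_def by auto
qed

text \<open>Both neighbours on the cycle of a vertex of maximal depth would have to be its parent.\<close>

lemma acyclic_parent_edges: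
  fixes d :: "'v \<Rightarrow> nat"
  assumes d: "\<And>v. v \<in> V - {r} \<Longrightarrow> d (f v) < d v"
  shows "\<not> graph_cycle (V, parent_edges V r f) c"
proof
  assume c: "graph_cycle (V, parent_edges V r f) c"
  let ?L = "length c"
  have L: "3 \<le> ?L" and dist: "distinct c"
    and E: "\<And>i. i < ?L \<Longrightarrow> {c ! i, c ! (Suc i mod ?L)} \<in> parent_edges V r f"
    using c unfolding graph_cycle_def by auto
  let ?D = "(\<lambda>i. d (c ! i)) ` {..<?L}"
  have "Max ?D \<in> ?D" using L by (intro Max_in) (auto simp: lessThan_empty_iff)
  then obtain i where "i < ?L" "Max ?D = d (c ! i)" by auto
  then have i: "i < ?L" and max: "\<And>j. j < ?L \<Longrightarrow> d (c ! j) \<le> d (c ! i)"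
    by (auto simp flip: \<open>Max ?D = d (c ! i)\<close>)
  define nx where "nx = Suc i mod ?L"
  define pv where "pv = (if i = 0 then ?L - 1 else i - 1)"
  have nx: "nx = (if Suc i = ?L then 0 else Suc i)"
    using i unfolding nx_def by auto
  \<comment> \<open>Here the length of at least 3 enters: on a closed walk of two vertices successor
    and predecessor coincide.\<close>
  have less: "nx < ?L" "pv < ?L" and spv: "Suc pv mod ?L = i" and ne: "nx \<noteq> pv"
    using L i unfolding nx pv_def by auto
  \<comment> \<open>In an edge \<open>{v, f v}\<close> the child is strictly deeper, so the endpoint
    of maximal depth must be the child.\<close>
  have parent: "y = f (c ! i)" if y: "{c ! i, y} \<in> parent_edges V r f" "d y \<le> d (c ! i)" for y
  proof -
    obtain v where v: "v \<in> V - {r}" "{c ! i, y} = {v, f v}"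
      using y(1) unfolding parent_edges_def by auto
    then show ?thesis using d[OF v(1)] y(2) by (auto simp: doubleton_eq_iff)
  qed
  have "c ! nx = f (c ! i)"
    using parent[of "c ! nx"] E[OF i] max[OF less(1)] unfolding nx_def by auto
  moreover have "c ! pv = f (c ! i)"
    using parent[of "c ! pv"] E[OF less(2)] max[OF less(2)] unfolding spv by (auto simp: insert_commute)
  ultimately show False using dist less ne by (metis nth_eq_iff_index_eq)
qed

text \<open>If \<open>f v\<close> and \<open>g v\<close> differ, the edge \<open>{v, f v}\<close>
  can occur for \<open>g\<close> only as the parent edge of \<open>f v\<close>, so
  \<open>g (f v) = v\<close>. Induction on the depth turns this into \<open>f (f v) = v\<close>,
  impossible as the depth strictly decreases.\<close>

lemma inj_on_parent_edges: "inj_on (parent_edges V r) (parent_maps (V, E) r)"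
proof (rule inj_onI)
  fix f g assume f: "f \<in> parent_maps (V, E) r" and g: "g \<in> parent_maps (V, E) r"
    and eq: "parent_edges V r f = parent_edges V r g"
  from f obtain d :: "'a \<Rightarrow> nat" where d: "\<And>v. v \<in> V - {r} \<Longrightarrow> d (f v) < d v"
    and fP: "f \<in> (\<Pi>\<^sub>E v\<in>V - {r}. {u\<in>V. {v, u} \<in> E})"
    unfolding parent_maps_def by auto
  from g obtain d' :: "'a \<Rightarrow> nat" where d': "\<And>v. v \<in> V - {r} \<Longrightarrow> d' (g v) < d' v"
    and gP: "g \<in> (\<Pi>\<^sub>E v\<in>V - {r}. {u\<in>V. {v, u} \<in> E})"
    unfolding parent_maps_def by auto
  have "f v = g v" if "v \<in> V - {r}" for v
    using that
  proof (induction "d v" arbitrary: v rule: less_induct)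
    case less
    show ?case
    proof (rule ccontr)
      assume ne: "f v \<noteq> g v"
      have "{v, f v} \<in> parent_edges V r g"
        using less.prems unfolding eq[symmetric] by (simp add: parent_edges_def)
      then obtain w where w: "w \<in> V - {r}" "{v, f v} = {w, g w}"
        unfolding parent_edges_def by auto
      with ne have fv: "f v \<in> V - {r}" "g (f v) = v" by (auto simp: doubleton_eq_iff)
      have "f (f v) = v" using less.hyps[OF d[OF less.prems] fv(1)] fv(2) by simp
      then show False using d[OF less.prems] d[OF fv(1)] by simp
    qed
  qed
  then show "f = g" using PiE_ext[OF fP gP] by blast
qed

lemma rtrancl_imp_distinct_path:
  assumes "(x, y) \<in> R\<^sup>*"
  obtains p where "p \<noteq> []" "hd p = x" "last p = y" "distinct p"
    "successively (\<lambda>u v. (u, v) \<in> R) p"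
proof -
  have "\<exists>p. p \<noteq> [] \<and> hd p = x \<and> last p = y \<and> distinct p \<and> successively (\<lambda>u v. (u, v) \<in> R) p"
    using assms
  proof (induction rule: converse_rtrancl_induct)
    case base
    show ?case by (rule exI[of _ "[y]"]) auto
  next
    case (step x x')
    then obtain p where p: "p \<noteq> []" "hd p = x'" "last p = y" "distinct p"
      "successively (\<lambda>u v. (u, v) \<in> R) p" by blast
    show ?case
    proof (cases "x \<in> set p")
      case True
      then obtain as bs where "p = as @ x # bs" by (meson split_list)
      with p show ?thesis
        by (intro exI[of _ "x # bs"]) (auto simp: successively_append_iff)
    next
      case False
      with p step.hyps(1) show ?thesis
        by (intro exI[of _ "x # p"]) (auto simp: successively_Cons)
    qed
  qed
  then show ?thesis using that by blast
qed

text \<open>The new edge closes a simple path in \<open>F'\<close>. That path has at least three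
  vertices because the edge itself is missing from \<open>F'\<close>.\<close>

lemma closing_edge_graph_cycle:
  assumes xy: "(x, y) \<in> {(u, v). {u, v} \<in> F'}\<^sup>*" and "x \<noteq> y" and "F' \<subseteq> F"
    and "{x, y} \<in> F" and "{x, y} \<notin> F'"
  shows "\<exists>c. graph_cycle (V, F) c"
proof -
  obtain p where p: "p \<noteq> []" "hd p = x" "last p = y" "distinct p"
    "successively (\<lambda>u v. (u, v) \<in> {(u, v). {u, v} \<in> F'}) p"
    using rtrancl_imp_distinct_path[OF xy] by metis
  have len: "3 \<le> length p"
  proof (rule ccontr)
    assume "\<not> ?thesis"
    moreover obtain a q where "p = a # q" using p(1) by (cases p) auto
    ultimately consider "p = [a]" | b where "p = [a, b]" by (cases q rule: list.exhaust; cases "tl q") auto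
    then show False using p assms by cases auto
  qed
  have "{p ! i, p ! (Suc i mod length p)} \<in> F" if i: "i < length p" for i
  proof (cases "Suc i = length p")
    case True
    then have "p ! i = y" using p(1,3) by (auto simp: last_conv_nth simp flip: True)
    moreover have "p ! 0 = x" using p(1,2) by (simp add: hd_conv_nth)
    ultimately show ?thesis using True assms(4) by (simp add: insert_commute)
  next
    case False
    then have "Suc i < length p" using i by simp
    then show ?thesis using p(5) assms(3) by (auto simp: successively_conv_nth)
  qed
  then show ?thesis using len p(4) unfolding graph_cycle_def by auto
qed

text \<open>The parent is a neighbour nearer to \<open>r\<close> in the tree. The parent edges alone
  already connect \<open>V\<close>, so a further edge of \<open>F\<close> would close a
  cycle.\<close>

lemma tree_is_parent_edges:
  assumes r: "r \<in> V" and E: "\<And>e. e \<in> E \<Longrightarrow> \<exists>u\<in>V. \<exists>v\<in>V. e = {u, v} \<and> u \<noteq> v"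
    and F: "F \<subseteq> E" and tree: "graph_tree (V, F)"
  shows "F \<in> parent_edges V r ` parent_maps (V, E) r"
proof -
  define R where "R = {(x, y). {x, y} \<in> F}"
  define d where "d v = (LEAST k. (v, r) \<in> R ^^ k)" for v
  have step: "\<exists>u\<in>V. {v, u} \<in> F \<and> d u < d v" if v: "v \<in> V - {r}" for v
  proof -
    have "(v, r) \<in> R\<^sup>*" using tree r v unfolding graph_tree_def graph_connected_def R_def by auto
    then obtain k where "(v, r) \<in> R ^^ k" using rtrancl_imp_relpow by blast
    then have dv: "(v, r) \<in> R ^^ d v" unfolding d_def by (rule LeastI)
    with v obtain k where k: "d v = Suc k" by (cases "d v") auto
    with dv obtain u where u: "(v, u) \<in> R" "(u, r) \<in> R ^^ k" by (metis relpow_Suc_D2)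
    then have "d u \<le> k" unfolding d_def by (simp add: Least_le)
    moreover have "u \<in> V" using u(1) F E[of "{v, u}"] unfolding R_def by (auto simp: doubleton_eq_iff)
    ultimately show ?thesis using k u(1) unfolding R_def by auto
  qed
  define f where "f = (\<lambda>v\<in>V - {r}. SOME u. u \<in> V \<and> {v, u} \<in> F \<and> d u < d v)"
  have f: "f v \<in> V" "{v, f v} \<in> F" "d (f v) < d v" if "v \<in> V - {r}" for v
    using someI_ex[of "\<lambda>u. u \<in> V \<and> {v, u} \<in> F \<and> d u < d v"] step[OF that] that
    unfolding f_def by auto
  have "f \<in> parent_maps (V, E) r"
    unfolding parent_maps_def using f F by (auto simp: f_def) 
  moreover have sub: "parent_edges V r f \<subseteq> F" unfolding parent_edges_def using f(2) by auto
  moreover have "F \<subseteq> parent_edges V r f"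
  proof
    fix e assume e: "e \<in> F"
    then obtain x y where xy: "x \<in> V" "y \<in> V" "e = {x, y}" "x \<noteq> y" using E F by blast
    have "graph_connected (V, parent_edges V r f)"
      using connected_parent_edges[of r V f d] r f by blast
    then have "(x, y) \<in> {(u, v). {u, v} \<in> parent_edges V r f}\<^sup>*"
      using xy unfolding graph_connected_def by auto
    then show "e \<in> parent_edges V r f"
      using closing_edge_graph_cycle[OF _ xy(4) sub] e xy(3) tree unfolding graph_tree_def by blast
  qed
  ultimately show ?thesis by blast
qed

lemma spanning_tree_count_parent_maps:
  assumes r: "r \<in> V" and E: "\<And>e. e \<in> E \<Longrightarrow> \<exists>u\<in>V. \<exists>v\<in>V. e = {u, v} \<and> u \<noteq> v"
  shows "\<tau> (V, E) = card (parent_maps (V, E) r)"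
proof -
  have "parent_edges V r ` parent_maps (V, E) r = {F. F \<subseteq> E \<and> graph_tree (V, F)}"
  proof (intro equalityI subsetI)
    fix F assume "F \<in> parent_edges V r ` parent_maps (V, E) r"
    then obtain f and d :: "'a \<Rightarrow> nat" where F: "F = parent_edges V r f"
      and f: "\<And>v. v \<in> V - {r} \<Longrightarrow> f v \<in> V \<and> {v, f v} \<in> E"
      and d: "\<And>v. v \<in> V - {r} \<Longrightarrow> d (f v) < d v"
      unfolding parent_maps_def by (auto simp: PiE_iff)
    have "graph_tree (V, F)" unfolding graph_tree_def F
      using connected_parent_edges[of r V f d] acyclic_parent_edges[of V r d f] r f d by blast
    moreover have "F \<subseteq> E" unfolding F parent_edges_def using f by auto
    ultimately show "F \<in> {F. F \<subseteq> E \<and> graph_tree (V, F)}" by auto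
  qed (use tree_is_parent_edges[OF r E] in auto)
  then show ?thesis
    unfolding spanning_tree_count_def using inj_on_parent_edges[of V r E] card_image by fastforce
qed

section \<open>The matrix-tree theorem\<close>

text \<open>The matrix I - A, where A is the transition matrix of \<open>f\<close> on the indexed
  vertices. A vertex whose parent is not indexed, as the root will be, yields a row of the
  identity.\<close>

definition parent_matrix :: "nat \<Rightarrow> (nat \<Rightarrow> 'v) \<Rightarrow> ('v \<Rightarrow> 'v) \<Rightarrow> 'a :: idom mat" where
  "parent_matrix k v f =
     mat k k (\<lambda>(i, j). (if i = j then 1 else 0) - (if f (v i) = v j then 1 else 0))"

lemma parent_matrix_carrier: "parent_matrix k v f \<in> carrier_mat k k"
  by (simp add: parent_matrix_def)

text \<open>A permutation contributing to the determinant moves an index only to its parent; the moved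
  index of least depth would have its parent moved as well.\<close>

lemma det_parent_matrix_acyclic:
  fixes d :: "'v \<Rightarrow> nat"
  assumes v: "bij_betw v {0..<k} W" and d: "\<And>w. w \<in> W \<Longrightarrow> d (f w) < d w"
  shows "det (parent_matrix k v f :: 'a :: idom mat) = 1"
proof -
  let ?M = "parent_matrix k v f :: 'a mat"
  have vW: "v i \<in> W" if "i < k" for i using v that unfolding bij_betw_def by auto
  have zero: "(\<Prod>i = 0..<k. ?M $$ (i, p i)) = 0" if p: "p permutes {0..<k}" and "p \<noteq> id" for p
  proof (rule ccontr)
    assume "\<not> ?thesis"
    then have nz: "?M $$ (i, p i) \<noteq> 0" if "i < k" for i
      using that by auto
    have fix_p: "p i = i" if "i < k" for i
      using that
    proof (induction "d (v i)" arbitrary: i rule: less_induct)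
      case less
      have pi: "p i < k" using permutes_in_image[OF p, of i] less.prems by auto
      show ?case
      proof (rule ccontr)
        assume ne: "p i \<noteq> i"
        then have "f (v i) = v (p i)" using nz[OF less.prems] less.prems pi
          unfolding parent_matrix_def by (auto split: if_splits)
        then have "p (p i) = p i" using less.hyps[of "p i"] pi d[OF vW[OF less.prems]] by simp
        then show False using ne permutes_inj[OF p] by (auto dest: injD)
      qed
    qed
    have "p = id"
    proof
      fix x show "p x = id x" using fix_p[of x] p unfolding permutes_def by (cases "x < k") auto
    qed
    then show False using that by simp
  qed
  have one: "(\<Prod>i = 0..<k. ?M $$ (i, id i)) = 1"
  proof (rule prod.neutral, safe)
    fix i assume "i \<in> {0..<k}"
    then show "?M $$ (i, id i) = 1"
      using d[OF vW[of i]] by (auto simp: parent_matrix_def)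
  qed
  have "det ?M = (\<Sum>p\<in>{p. p permutes {0..<k}}. signof p * (\<Prod>i = 0..<k. ?M $$ (i, p i)))"
    by (rule det_def'[OF parent_matrix_carrier])
  also have "\<dots> = (\<Sum>p\<in>{id}. signof p * (\<Prod>i = 0..<k. ?M $$ (i, p i)))"
    using zero by (intro sum.mono_neutral_right) (auto simp: finite_permutations permutes_id)
  also have "\<dots> = 1" using one by simp
  finally show ?thesis .
qed

text \<open>The indicator of the set of vertices that never reach the root is in the kernel.\<close>

lemma det_parent_matrix_cyclic:
  assumes v: "bij_betw v {0..<k} W" and r: "r \<notin> W"
    and f: "\<And>w. w \<in> W \<Longrightarrow> f w \<in> insert r W"
    and cyc: "\<nexists>d::'v \<Rightarrow> nat. \<forall>w\<in>W. d (f w) < d w"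
  shows "det (parent_matrix k v f :: 'a :: idom mat) = 0"
proof -
  let ?M = "parent_matrix k v f :: 'a mat"
  define R where "R = {(w, f w) | w. w \<in> W}"
  define C where "C = {w\<in>W. (w, r) \<notin> R\<^sup>*}"
  have vW: "v i \<in> W" if "i < k" for i using v that unfolding bij_betw_def by auto
  have "C \<noteq> {}"
  proof
    assume "C = {}"
    \<comment> \<open>If every vertex reached the root, the distance to it would be a decreasing
      potential.\<close>
    define d where "d w = (LEAST n. (w, r) \<in> R ^^ n)" for w
    have "d (f w) < d w" if w: "w \<in> W" for w
    proof -
      have "(w, r) \<in> R\<^sup>*" using \<open>C = {}\<close> w unfolding C_def by auto
      then obtain n where "(w, r) \<in> R ^^ n" using rtrancl_imp_relpow by blast
      then have dw: "(w, r) \<in> R ^^ d w" unfolding d_def by (rule LeastI)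
      with w r obtain n where n: "d w = Suc n" by (cases "d w") auto
      with dw obtain u where u: "(w, u) \<in> R" "(u, r) \<in> R ^^ n" by (metis relpow_Suc_D2)
      then have "u = f w" unfolding R_def by auto
      with u n show ?thesis unfolding d_def by (metis Least_le less_Suc_eq_le)
    qed
    then show False using cyc by blast
  qed
  \<comment> \<open>Closure in both directions is needed: row \<open>i\<close> of the product
    compares membership of \<open>v i\<close> with membership of its parent.\<close>
  have f_C: "f w \<in> C \<longleftrightarrow> w \<in> C" if w: "w \<in> W" for w
  proof -
    have wf: "(w, f w) \<in> R" using w unfolding R_def by auto
    have "(w, r) \<in> R\<^sup>* \<longleftrightarrow> (f w, r) \<in> R\<^sup>*"
    proof
      assume "(w, r) \<in> R\<^sup>*"
      then show "(f w, r) \<in> R\<^sup>*"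
        by (cases rule: converse_rtranclE) (use r w in \<open>auto simp: R_def\<close>)
    qed (use wf in \<open>blast intro: converse_rtrancl_into_rtrancl\<close>)
    then show ?thesis using f[OF w] w r unfolding C_def by auto
  qed
  define x :: "'a vec" where "x = vec k (\<lambda>i. if v i \<in> C then 1 else 0)"
  obtain w where w: "w \<in> C" using \<open>C \<noteq> {}\<close> by blast
  then have "w \<in> v ` {0..<k}" using v unfolding C_def bij_betw_def by auto
  then obtain i where i: "i < k" "v i = w" by auto
  have "x $ i \<noteq> 0\<^sub>v k $ i" using i w unfolding x_def by auto
  then have "x \<noteq> 0\<^sub>v k" by auto
  moreover have "?M *\<^sub>v x = 0\<^sub>v k"
  proof (rule eq_vecI)
    fix i assume "i < dim_vec (0\<^sub>v k :: 'a vec)"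
    then have i: "i < k" by simp
    have "(?M *\<^sub>v x) $ i = (\<Sum>j = 0..<k. ?M $$ (i, j) * x $ j)"
      using i by (simp add: scalar_prod_def parent_matrix_def x_def)
    also have "\<dots> = (\<Sum>j = 0..<k. (if i = j then x $ j else 0) - (if f (v i) = v j then x $ j else 0))"
      using i by (intro sum.cong) (auto simp: parent_matrix_def)
    also have "\<dots> = x $ i - (\<Sum>j = 0..<k. if f (v i) = v j then x $ j else 0)"
      using i by (simp add: sum_subtractf)
    also have "(\<Sum>j = 0..<k. if f (v i) = v j then x $ j else 0) =
        (\<Sum>j = 0..<k. if f (v i) = v j then if v j \<in> C then 1 else 0 else 0)"
      by (intro sum.cong) (auto simp: x_def)
    also have "\<dots> = (\<Sum>w\<in>W. if f (v i) = w then if w \<in> C then 1 else 0 else 0)"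
      by (rule sum.reindex_bij_betw[OF v])
    also have "\<dots> = (if f (v i) \<in> C then 1 else 0)"
      using bij_betw_finite[OF v] by (auto simp: C_def)
    finally show "(?M *\<^sub>v x) $ i = 0\<^sub>v k $ i"
      using f_C[OF vW[OF i]] i by (simp add: x_def)
  qed (simp add: parent_matrix_def)
  ultimately show ?thesis
    using det_0_iff_vec_prod_zero[of ?M k, OF parent_matrix_carrier]
    by (metis x_def vec_carrier)
qed

text \<open>Row \<open>i\<close> of the reduced Laplacian is the sum, over the neighbours u of
  \<open>v i\<close>, of the rows that a parent matrix has when \<open>v i\<close> is sent to u.
  Multilinearity turns the determinant into a sum over all choices of parents, and each summand is 1
  or 0 according to acyclicity.\<close>

lemma matrix_tree:
  fixes V :: "'v set" and v :: "nat \<Rightarrow> 'v"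
  assumes v: "bij_betw v {0..<k} (V - {r})" and r: "r \<in> V"
    and E: "\<And>e. e \<in> E \<Longrightarrow> \<exists>u\<in>V. \<exists>w\<in>V. e = {u, w} \<and> u \<noteq> w"
  shows "det (mat k k (\<lambda>(i, j). if i = j then of_nat (card {u\<in>V. {v i, u} \<in> E})
       else if {v i, v j} \<in> E then -1 else 0)) = (of_nat (\<tau> (V, E)) :: 'a :: {idom, ring_char_0})"
    (is "det ?A = _")
proof -
  let ?W = "V - {r}"
  define N where "N w = {u\<in>V. {w, u} \<in> E}" for w
  define j where "j = the_inv_into {0..<k} v"
  \<comment> \<open>The entry in the row of \<open>w\<close> and the column chosen by
    \<open>p\<close> of a parent matrix whose map sends \<open>w\<close> to
    \<open>u\<close>.\<close>
  define g :: "'v \<Rightarrow> 'v \<Rightarrow> (nat \<Rightarrow> nat) \<Rightarrow> 'a" where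
    "g w u p = (if j w = p (j w) then 1 else 0) - (if u = v (p (j w)) then 1 else 0)" for w u p
  have finW: "finite ?W" using bij_betw_finite[OF v] by simp
  then have finV: "finite V" using r by (metis finite_insert insert_Diff)
  have finN: "finite (N w)" for w unfolding N_def using finV by simp
  have jv: "j (v i) = i" if "i < k" for i
    using that v unfolding j_def bij_betw_def by (simp add: the_inv_into_f_f)
  have vinj: "v i = v i' \<longleftrightarrow> i = i'" if "i < k" "i' < k" for i i'
    using v that unfolding bij_betw_def by (auto dest: inj_onD)
  have vV: "v i \<in> V" if "i < k" for i using v that unfolding bij_betw_def by auto
  have entry: "?A $$ (i, p i) = (\<Sum>u\<in>N (v i). g (v i) u p)"
    if p: "p permutes {0..<k}" and i: "i < k" for p i
  proof -
    have pi: "p i < k" using permutes_in_image[OF p, of i] i by auto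
    have "(\<Sum>u\<in>N (v i). g (v i) u p) =
       (if i = p i then of_nat (card (N (v i))) else 0) - (if v (p i) \<in> N (v i) then 1 else 0)"
      unfolding g_def jv[OF i] sum_subtractf using finN by (simp add: sum.delta)
    \<comment> \<open>A loop would lower the diagonal entry below the degree.\<close>
    moreover have "v i \<notin> N (v i)" using E[of "{v i, v i}"] unfolding N_def by auto
    ultimately show ?thesis using i pi vV[OF pi] unfolding N_def by auto
  qed
  have "det ?A = (\<Sum>p\<in>{p. p permutes {0..<k}}. signof p * (\<Prod>i = 0..<k. ?A $$ (i, p i)))"
    by (rule det_def') simp
  also have "\<dots> = (\<Sum>p\<in>{p. p permutes {0..<k}}. signof p *
      (\<Sum>f\<in>Pi\<^sub>E ?W N. \<Prod>w\<in>?W. g w (f w) p))"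
  proof (intro sum.cong refl arg_cong2[of _ _ _ _ "(*)"])
    fix p assume "p \<in> {p. p permutes {0..<k}}"
    then have "(\<Prod>i = 0..<k. ?A $$ (i, p i)) = (\<Prod>i = 0..<k. \<Sum>u\<in>N (v i). g (v i) u p)"
      by (intro prod.cong refl entry) auto
    also have "\<dots> = (\<Prod>w\<in>?W. \<Sum>u\<in>N w. g w u p)" by (rule prod.reindex_bij_betw[OF v])
    also have "\<dots> = (\<Sum>f\<in>Pi\<^sub>E ?W N. \<Prod>w\<in>?W. g w (f w) p)"
      by (rule prod_sum_PiE[OF finW finN])
    finally show "(\<Prod>i = 0..<k. ?A $$ (i, p i)) = (\<Sum>f\<in>Pi\<^sub>E ?W N. \<Prod>w\<in>?W. g w (f w) p)" .
  qed
  also have "\<dots> = (\<Sum>f\<in>Pi\<^sub>E ?W N. \<Sum>p\<in>{p. p permutes {0..<k}}. signof p *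
      (\<Prod>w\<in>?W. g w (f w) p))"
    unfolding sum_distrib_left by (rule sum.swap)
  also have "\<dots> = (\<Sum>f\<in>Pi\<^sub>E ?W N. det (parent_matrix k v f))"
  proof (intro sum.cong refl)
    fix f
    have "(\<Prod>w\<in>?W. g w (f w) p) = (\<Prod>i = 0..<k. parent_matrix k v f $$ (i, p i))"
      if p: "p permutes {0..<k}" for p
    proof -
      have "(\<Prod>w\<in>?W. g w (f w) p) = (\<Prod>i = 0..<k. g (v i) (f (v i)) p)"
        by (rule prod.reindex_bij_betw[OF v, symmetric])
      also have "\<dots> = (\<Prod>i = 0..<k. parent_matrix k v f $$ (i, p i))"
        using permutes_in_image[OF p] by (intro prod.cong refl) (auto simp: g_def jv parent_matrix_def)
      finally show ?thesis .
    qed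
    then show "(\<Sum>p\<in>{p. p permutes {0..<k}}. signof p * (\<Prod>w\<in>?W. g w (f w) p)) =
        det (parent_matrix k v f)"
      unfolding det_def'[OF parent_matrix_carrier] by (intro sum.cong refl) auto
  qed
  also have "\<dots> = (\<Sum>f\<in>Pi\<^sub>E ?W N. if f \<in> parent_maps (V, E) r then 1 else 0)"
  proof (intro sum.cong refl)
    fix f assume f: "f \<in> Pi\<^sub>E ?W N"
    show "det (parent_matrix k v f) = (if f \<in> parent_maps (V, E) r then 1 else 0 :: 'a)"
    proof (cases "\<exists>d::'v \<Rightarrow> nat. \<forall>w\<in>?W. d (f w) < d w")
      case True
      then have "f \<in> parent_maps (V, E) r" using f unfolding parent_maps_def N_def by simp
      then show ?thesis using True det_parent_matrix_acyclic[OF v] by auto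
    next
      case False
      then have "f \<notin> parent_maps (V, E) r" unfolding parent_maps_def by simp
      moreover have "f w \<in> insert r ?W" if "w \<in> ?W" for w
        using PiE_mem[OF f that] unfolding N_def by auto
      ultimately show ?thesis using det_parent_matrix_cyclic[OF v _ _ False] by auto
    qed
  qed
  also have "\<dots> = of_nat (card (Pi\<^sub>E ?W N \<inter> parent_maps (V, E) r))"
    using finite_PiE[OF finW finN] by (simp add: sum.If_cases)
  also have "Pi\<^sub>E ?W N \<inter> parent_maps (V, E) r = parent_maps (V, E) r"
    unfolding parent_maps_def N_def by auto
  finally show ?thesis using spanning_tree_count_parent_maps[OF r E] by simp
qed

section \<open>From a principal minor of the Laplacian to the full matrix L + J\<close>

lemma index_mult_mat_sum:
  assumes "A \<in> carrier_mat n m" "B \<in> carrier_mat m l" "i < n" "j < l"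
  shows "(A * B) $$ (i, j) = (\<Sum>h = 0..<m. A $$ (i, h) * B $$ (h, j))"
  using assms by (simp add: scalar_prod_def)

text \<open>Replacing the last row and column of \<open>L + J\<close> by the sums of all rows and columns turns
  them into multiples of the all-ones vector, which then clear the block \<open>J\<close>.\<close>

lemma det_zero_sums_add_ones:
  fixes a :: "nat \<Rightarrow> nat \<Rightarrow> 'a :: field_char_0"
  assumes rows: "\<And>i. i \<le> k \<Longrightarrow> (\<Sum>j = 0..<Suc k. a i j) = 0"
    and cols: "\<And>j. j \<le> k \<Longrightarrow> (\<Sum>i = 0..<Suc k. a i j) = 0"
  shows "det (mat (Suc k) (Suc k) (\<lambda>(i, j). a i j + 1)) =
    (of_nat (Suc k))\<^sup>2 * det (mat k k (\<lambda>(i, j). a i j))"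
proof -
  let ?N = "of_nat (Suc k) :: 'a"
  let ?n = "Suc k"
  have N: "?N \<noteq> 0" by (simp del: of_nat_Suc)
  define M where "M = mat ?n ?n (\<lambda>(i, j). a i j + 1)"
  \<comment> \<open>Right multiplication by \<open>U\<close> puts the sum of all columns into the
    last one; the transpose on the left does the same to the rows.\<close>
  define U :: "'a mat" where "U = mat ?n ?n (\<lambda>(i, j). if i = j \<or> j = k then 1 else 0)"
  \<comment> \<open>\<open>Q\<close> subtracts the last row, divided by \<open>?N\<close>, from
    every other row. That row is \<open>?N\<close> off the corner and \<open>?N\<^sup>2\<close> in
    it, so the 1 in each \<open>a i j + 1\<close> and the \<open>?N\<close> in the last column both
    vanish.\<close>
  define Q :: "'a mat" where "Q = mat ?n ?n (\<lambda>(i, j). if i = j then 1 else if j = k then - (1 / ?N) else 0)"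
  define R where "R = four_block_mat (mat k k (\<lambda>(i, j). a i j)) (0\<^sub>m k 1)
     (mat 1 k (\<lambda>_. ?N)) (mat 1 1 (\<lambda>_. ?N\<^sup>2))"
  have carr: "M \<in> carrier_mat ?n ?n" "U \<in> carrier_mat ?n ?n" "Q \<in> carrier_mat ?n ?n"
    "transpose_mat U \<in> carrier_mat ?n ?n"
    unfolding M_def U_def Q_def by auto
  have MU: "M * U = mat ?n ?n (\<lambda>(i, j). if j = k then ?N else a i j + 1)"
  proof (rule eq_matI)
    fix i j assume "i < dim_row (mat ?n ?n (\<lambda>(i, j). if j = k then ?N else a i j + 1))"
      "j < dim_col (mat ?n ?n (\<lambda>(i, j). if j = k then ?N else a i j + 1))"
    then have ij: "i < ?n" "j < ?n" by auto
    have "(M * U) $$ (i, j) = (\<Sum>h = 0..<?n. M $$ (i, h) * U $$ (h, j))"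
      using ij by (intro index_mult_mat_sum[OF carr(1,2)])
    also have "\<dots> = (\<Sum>h = 0..<?n. if j = k then a i h + 1 else if h = j then a i h + 1 else 0)"
      using ij by (intro sum.cong) (auto simp: M_def U_def)
    also have "\<dots> = (if j = k then ?N else a i j + 1)"
      using ij rows[of i] by (cases "j = k") (simp_all add: sum.distrib del: sum.op_ivl_Suc of_nat_Suc)
    finally show "(M * U) $$ (i, j) = mat ?n ?n (\<lambda>(i, j). if j = k then ?N else a i j + 1) $$ (i, j)"
      using ij by simp
  qed (auto simp: M_def U_def)
  let ?T = "mat ?n ?n (\<lambda>(i, j). if i = k \<and> j = k then ?N\<^sup>2 else if i = k \<or> j = k then ?N else a i j + 1)"
  have UMU: "transpose_mat U * (M * U) = ?T"
  proof (rule eq_matI)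
    fix i j assume "i < dim_row ?T" "j < dim_col ?T"
    then have ij: "i < ?n" "j < ?n" by auto
    have "(transpose_mat U * (M * U)) $$ (i, j) = (\<Sum>h = 0..<?n. transpose_mat U $$ (i, h) * (M * U) $$ (h, j))"
      using ij carr by (intro index_mult_mat_sum) auto
    also have "\<dots> = (\<Sum>h = 0..<?n. if i = k then (if j = k then ?N else a h j + 1)
        else if h = i then (if j = k then ?N else a i j + 1) else 0)"
      using ij unfolding MU by (intro sum.cong) (auto simp: U_def)
    also have "\<dots> = ?T $$ (i, j)"
      using ij cols[of j] by (cases "i = k"; cases "j = k")
        (simp_all add: sum.distrib power2_eq_square del: sum.op_ivl_Suc of_nat_Suc)
    finally show "(transpose_mat U * (M * U)) $$ (i, j) = ?T $$ (i, j)" .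
  qed (auto simp: M_def U_def)
  have QUMU: "Q * (transpose_mat U * (M * U)) = R"
  proof (rule eq_matI)
    fix i j assume "i < dim_row R" "j < dim_col R"
    then have ij: "i < ?n" "j < ?n" by (auto simp: R_def)
    have "(Q * (transpose_mat U * (M * U))) $$ (i, j) =
        (\<Sum>h = 0..<?n. Q $$ (i, h) * (transpose_mat U * (M * U)) $$ (h, j))"
      using ij carr by (intro index_mult_mat_sum) auto
    also have "\<dots> = (\<Sum>h = 0..<?n. (if h = i then ?T $$ (i, j) else 0) +
        (if h = k then (if i = k then 0 else - (1 / ?N) * ?T $$ (k, j)) else 0))"
      using ij unfolding UMU by (intro sum.cong) (auto simp: Q_def)
    also have "\<dots> = R $$ (i, j)"
      using ij N by (simp add: sum.distrib R_def power2_eq_square field_simps del: sum.op_ivl_Suc of_nat_Suc)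
    finally show "(Q * (transpose_mat U * (M * U))) $$ (i, j) = R $$ (i, j)" .
  qed (auto simp: M_def U_def Q_def R_def)
  have detU: "det U = 1"
  proof -
    have "upper_triangular U" unfolding U_def by auto
    then have "det U = prod_list (diag_mat U)" by (rule det_upper_triangular) (rule carr)
    also have "diag_mat U = map (\<lambda>_. 1) [0..<?n]" unfolding diag_mat_def U_def by (auto simp del: upt_Suc)
    finally show ?thesis by (simp add: prod_list_replicate map_replicate_const del: upt_Suc)
  qed
  have detQ: "det Q = 1"
  proof -
    have "upper_triangular Q" unfolding Q_def by auto
    then have "det Q = prod_list (diag_mat Q)" by (rule det_upper_triangular) (rule carr)
    also have "diag_mat Q = map (\<lambda>_. 1) [0..<?n]" unfolding diag_mat_def Q_def by (auto simp del: upt_Suc)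
    finally show ?thesis by (simp add: prod_list_replicate map_replicate_const del: upt_Suc)
  qed
  have "det R = det Q * (det (transpose_mat U) * (det M * det U))"
    unfolding QUMU[symmetric] using carr by (simp add: det_mult[of _ ?n])
  also have "\<dots> = det M" using det_transpose[OF carr(2)] detU detQ by simp
  also have "det R = det (mat k k (\<lambda>(i, j). a i j)) * det (mat 1 1 (\<lambda>_. ?N\<^sup>2))"
    unfolding R_def by (rule det_four_block_mat_upper_right_zero[of _ k _ 1]) auto
  also have "det (mat 1 1 (\<lambda>_. ?N\<^sup>2)) = ?N\<^sup>2" by (subst det_single) auto
  finally show ?thesis unfolding M_def by (simp add: mult.commute)
qed

text \<open>All vertices are treated alike, so the symmetry of the graph survives in the matrix.
  Degrees are counted on indices, where counting residues will give them. The choice of the last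
  vertex as root is internal to the proof.\<close>

lemma matrix_tree_add_ones:
  fixes V :: "'v set" and v :: "nat \<Rightarrow> 'v"
  assumes v: "bij_betw v {0..<n} V" and n: "n > 0"
    and E: "\<And>e. e \<in> E \<Longrightarrow> \<exists>u\<in>V. \<exists>w\<in>V. e = {u, w} \<and> u \<noteq> w"
  shows "det (mat n n (\<lambda>(i, j). (if i = j then of_nat (card {h. h < n \<and> {v i, v h} \<in> E})
       else if {v i, v j} \<in> E then -1 else 0) + 1)) =
     (of_nat n)\<^sup>2 * (of_nat (\<tau> (V, E)) :: 'a :: field_char_0)"
proof -
  obtain k where k: "n = Suc k" using n by (cases n) auto
  let ?r = "v k"
  define a where "a i j = (if i = j then of_nat (card {h. h < n \<and> {v i, v h} \<in> E})
       else if {v i, v j} \<in> E then -1 else 0 :: 'a)" for i j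
  have r: "?r \<in> V" using v k unfolding bij_betw_def by auto
  have v': "bij_betw v {0..<k} (V - {?r})"
  proof -
    have "bij_betw v ({0..<n} - {k}) (V - v ` {k})"
      using v k by (intro bij_betw_subset[OF v] ) (auto simp: bij_betw_def inj_on_def)
    moreover have "{0..<n} - {k} = {0..<k}" using k by auto
    ultimately show ?thesis by simp
  qed
  have noloop: "{x} \<notin> E" for x using E[of "{x}"] by (auto simp: doubleton_eq_iff)
  have sums: "(\<Sum>j = 0..<n. a i j) = 0" if i: "i < n" for i
  proof -
    have "(\<Sum>j = 0..<n. a i j) = (\<Sum>j = 0..<n. (if j = i then of_nat (card {h. h < n \<and> {v i, v h} \<in> E}) else 0)
        - (if {v i, v j} \<in> E then 1 else 0))"
      using noloop by (intro sum.cong) (auto simp: a_def)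
    also have "\<dots> = of_nat (card {h. h < n \<and> {v i, v h} \<in> E})
        - of_nat (card ({0..<n} \<inter> {h. {v i, v h} \<in> E}))"
      using i by (simp add: sum_subtractf sum.If_cases)
    also have "{0..<n} \<inter> {h. {v i, v h} \<in> E} = {h. h < n \<and> {v i, v h} \<in> E}" by auto
    finally show ?thesis by simp
  qed
  have sym: "a i j = a j i" for i j unfolding a_def by (auto simp: insert_commute)
  have "det (mat n n (\<lambda>(i, j). a i j + 1)) = (of_nat n)\<^sup>2 * det (mat k k (\<lambda>(i, j). a i j))"
    unfolding k using sums sym k by (intro det_zero_sums_add_ones) auto
  also have "mat k k (\<lambda>(i, j). a i j) = mat k k (\<lambda>(i, j).
      if i = j then of_nat (card {u\<in>V. {v i, u} \<in> E}) else if {v i, v j} \<in> E then -1 else 0)"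
  proof (rule cong_mat)
    fix i j assume "i < k" "j < k"
    have "bij_betw v {h. h < n \<and> {v i, v h} \<in> E} {u\<in>V. {v i, u} \<in> E}"
      using v by (force simp: bij_betw_def inj_on_def)
    then have "card {h. h < n \<and> {v i, v h} \<in> E} = card {u\<in>V. {v i, u} \<in> E}"
      by (rule bij_betw_same_card)
    then show "(case (i, j) of (i, j) \<Rightarrow> a i j) = (case (i, j) of (i, j) \<Rightarrow>
      if i = j then of_nat (card {u\<in>V. {v i, u} \<in> E}) else if {v i, v j} \<in> E then -1 else 0)"
      unfolding a_def by auto
  qed auto
  also have "det \<dots> = of_nat (\<tau> (V, E))" by (rule matrix_tree[OF v' r E])
  finally show ?thesis unfolding a_def .
qed

section \<open>Block circulant determinants\<close>

text \<open>A null vector of the transpose would be the coefficient list of a nonzero polynomial of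
  degree below \<open>k\<close> with \<open>k\<close> distinct roots.\<close>

lemma det_vandermonde_nonzero:
  fixes x :: "nat \<Rightarrow> 'a :: idom"
  assumes x: "inj_on x {0..<k}"
  shows "det (mat k k (\<lambda>(i, j). x j ^ i)) \<noteq> 0"
proof
  let ?V = "mat k k (\<lambda>(i, j). x j ^ i)"
  assume "det ?V = 0"
  then have "det (transpose_mat ?V) = 0" by (subst det_transpose[of _ k]) auto
  then obtain c where c: "c \<in> carrier_vec k" "c \<noteq> 0\<^sub>v k" "transpose_mat ?V *\<^sub>v c = 0\<^sub>v k"
    using det_0_iff_vec_prod_zero[of "transpose_mat ?V" k] by auto
  define p where "p = (\<Sum>i = 0..<k. monom (c $ i) i)"
  have coeff_p: "coeff p i = (if i < k then c $ i else 0)" for i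
    by (simp add: p_def coeff_sum)
  have roots: "poly p (x j) = 0" if j: "j < k" for j
  proof -
    have "poly p (x j) = (\<Sum>i = 0..<k. x j ^ i * c $ i)"
      by (simp add: p_def poly_sum poly_monom mult.commute)
    also have "\<dots> = (transpose_mat ?V *\<^sub>v c) $ j"
      using j c(1) by (simp add: scalar_prod_def)
    finally show ?thesis using c(3) j by simp
  qed
  have "p = 0"
  proof (rule ccontr)
    assume p: "p \<noteq> 0"
    have "k = card (x ` {0..<k})" using card_image[OF x] by simp
    also have "\<dots> \<le> card {y. poly p y = 0}"
      using roots by (intro card_mono poly_roots_finite[OF p]) auto
    also have "\<dots> \<le> degree p" using card_poly_roots_bound[OF p] .
    finally have "coeff p (degree p) = 0" unfolding coeff_p by simp
    then show False using p by simp
  qed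
  then have "c $ i = 0" if "i < k" for i using coeff_p[of i] that by simp
  then have "c = 0\<^sub>v k" using c(1) by (intro eq_vecI) auto
  then show False using c(2) by simp
qed

definition diagonal_mat_of :: "nat \<Rightarrow> (nat \<Rightarrow> 'a :: zero) \<Rightarrow> 'a mat" where
  "diagonal_mat_of n d = mat n n (\<lambda>(i, j). if i = j then d i else 0)"

lemma diagonal_mat_of_carrier [simp]: "diagonal_mat_of n d \<in> carrier_mat n n"
  by (simp add: diagonal_mat_of_def)

lemma diagonal_mat_of_dim [simp]:
  "dim_row (diagonal_mat_of n d) = n" "dim_col (diagonal_mat_of n d) = n"
  by (simp_all add: diagonal_mat_of_def)

lemma mult_diagonal_mat_of_right:
  fixes A :: "'a :: semiring_1 mat"
  assumes "A \<in> carrier_mat n n"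
  shows "A * diagonal_mat_of n d = mat n n (\<lambda>(i, j). A $$ (i, j) * d j)"
proof (rule eq_matI)
  fix i j assume "i < dim_row (mat n n (\<lambda>(i, j). A $$ (i, j) * d j))"
    "j < dim_col (mat n n (\<lambda>(i, j). A $$ (i, j) * d j))"
  then have ij: "i < n" "j < n" by auto
  have "(A * diagonal_mat_of n d) $$ (i, j) = (\<Sum>h = 0..<n. A $$ (i, h) * diagonal_mat_of n d $$ (h, j))"
    using ij assms by (intro index_mult_mat_sum) auto
  also have "\<dots> = (\<Sum>h = 0..<n. if h = j then A $$ (i, h) * d j else 0)"
    using ij by (intro sum.cong) (auto simp: diagonal_mat_of_def)
  finally show "(A * diagonal_mat_of n d) $$ (i, j) = mat n n (\<lambda>(i, j). A $$ (i, j) * d j) $$ (i, j)"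
    using ij by simp
qed (use assms in auto)

lemma diagonal_mat_of_mult:
  fixes d e :: "nat \<Rightarrow> 'a :: semiring_1"
  shows "diagonal_mat_of n d * diagonal_mat_of n e = diagonal_mat_of n (\<lambda>i. d i * e i)"
  unfolding mult_diagonal_mat_of_right[OF diagonal_mat_of_carrier]
  by (auto simp: diagonal_mat_of_def intro!: eq_matI)

lemma det_diagonal_mat_of: "det (diagonal_mat_of n d) = (\<Prod>j = 0..<n. d j)"
proof -
  have "upper_triangular (diagonal_mat_of n d)" unfolding diagonal_mat_of_def by auto
  then have "det (diagonal_mat_of n d) = prod_list (diag_mat (diagonal_mat_of n d))"
    by (rule det_upper_triangular[OF _ diagonal_mat_of_carrier])
  then show ?thesis by (simp add: prod_list_diag_prod) (simp add: diagonal_mat_of_def)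
qed

section \<open>Roots of unity and the Fourier basis\<close>

definition zeta :: "nat \<Rightarrow> nat \<Rightarrow> complex" where
  "zeta n j = cis (2 * pi * real j / real n)"

lemma zeta_nonzero [simp]: "zeta n j \<noteq> 0"
  by (simp add: zeta_def)

lemma zeta_power_n: "n > 0 \<Longrightarrow> zeta n j ^ n = 1"
  by (simp add: zeta_def DeMoivre cis_multiple_2pi)

lemma zeta_0 [simp]: "zeta n 0 = 1"
  by (simp add: zeta_def)

lemma inj_on_zeta: "inj_on (zeta n) {0..<n}"
proof (cases "n = 0")
  case False
  then show ?thesis
    using bij_betw_imp_inj_on[OF bij_betw_roots_unity[of n]]
    unfolding zeta_def by (simp add: atLeast0LessThan)
qed simp

lemma power_int_mod:
  fixes z :: "'a :: field"
  assumes "z ^ n = 1" "z \<noteq> 0"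
  shows "z powi (k mod int n) = z powi k"
proof -
  have "z powi k = z powi (int n * (k div int n) + k mod int n)" by simp
  also have "\<dots> = (z powi int n) powi (k div int n) * z powi (k mod int n)"
    using assms(2) by (simp only: power_int_add power_int_mult simp_thms)
  finally show ?thesis using assms(1) by simp
qed

lemma bij_betw_residue_shift:
  assumes "n > 0"
  shows "bij_betw (\<lambda>h. (int h - a) mod int n) {0..<n} {0..<int n}"
proof -
  have "inj_on (\<lambda>h. (int h - a) mod int n) {0..<n}"
  proof (rule inj_onI)
    fix h h' assume h: "h \<in> {0..<n}" "h' \<in> {0..<n}" "(int h - a) mod int n = (int h' - a) mod int n"
    then have "int n dvd (int h - int h')" by (simp add: mod_eq_dvd_iff)
    then have "int h mod int n = int h' mod int n" by (simp add: mod_eq_dvd_iff)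
    then show "h = h'" using h by simp
  qed
  moreover have "(\<lambda>h. (int h - a) mod int n) ` {0..<n} \<subseteq> {0..<int n}" using assms by auto
  ultimately have "(\<lambda>h. (int h - a) mod int n) ` {0..<n} = {0..<int n}"
    by (intro card_subset_eq) (simp_all add: card_image)
  with \<open>inj_on _ _\<close> show ?thesis by (simp add: bij_betw_def)
qed

definition circulant :: "nat \<Rightarrow> (int \<Rightarrow> 'a) \<Rightarrow> 'a mat" where
  "circulant n c = mat n n (\<lambda>(i, j). c ((int j - int i) mod int n))"

lemma circulant_carrier [simp]: "circulant n c \<in> carrier_mat n n"
  by (simp add: circulant_def)

text \<open>The eigenvalue of the circulant matrix on the Fourier vector with entries
  \<open>zeta n j ^ i\<close>.\<close>

definition symbol :: "nat \<Rightarrow> (int \<Rightarrow> complex) \<Rightarrow> nat \<Rightarrow> complex" where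
  "symbol n c j = (\<Sum>k\<in>{0..<int n}. c k * zeta n j powi k)"

text \<open>Since \<open>zeta n j ^ n = 1\<close>, exponents may be reduced modulo \<open>n\<close>.
  Factoring \<open>zeta n j ^ i\<close> out of row \<open>i\<close> leaves a sum over shifted
  residues, which is the same for every row.\<close>

lemma circulant_mult_fourier:
  "circulant n c * mat n n (\<lambda>(i, j). zeta n j ^ i) =
    mat n n (\<lambda>(i, j). zeta n j ^ i) * diagonal_mat_of n (symbol n c)"
  (is "_ * ?F = _")
proof (cases "n = 0")
  case n: False
  show ?thesis unfolding mult_diagonal_mat_of_right[of ?F n, OF mat_carrier]
  proof (rule eq_matI)
    fix i j assume "i < dim_row (mat n n (\<lambda>(i, j). ?F $$ (i, j) * symbol n c j))"
      "j < dim_col (mat n n (\<lambda>(i, j). ?F $$ (i, j) * symbol n c j))"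
    then have ij: "i < n" "j < n" by auto
    let ?z = "zeta n j"
    have "(circulant n c * ?F) $$ (i, j) = (\<Sum>h = 0..<n. circulant n c $$ (i, h) * ?F $$ (h, j))"
      using ij by (intro index_mult_mat_sum) auto
    also have "\<dots> = (\<Sum>h = 0..<n. ?z ^ i * (c ((int h - int i) mod int n) * ?z powi ((int h - int i) mod int n)))"
      using ij n by (intro sum.cong refl)
        (simp add: circulant_def power_int_mod zeta_power_n power_int_diff)
    also have "\<dots> = ?z ^ i * (\<Sum>h = 0..<n. c ((int h - int i) mod int n) * ?z powi ((int h - int i) mod int n))"
      by (simp add: sum_distrib_left)
    also have "(\<Sum>h = 0..<n. c ((int h - int i) mod int n) * ?z powi ((int h - int i) mod int n)) = symbol n c j"
      unfolding symbol_def using n by (intro sum.reindex_bij_betw[OF bij_betw_residue_shift]) simp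
    finally show "(circulant n c * ?F) $$ (i, j) = mat n n (\<lambda>(i, j). ?F $$ (i, j) * symbol n c j) $$ (i, j)"
      using ij by simp
  qed (auto simp: circulant_def)
qed (auto simp: circulant_def diagonal_mat_of_def)

text \<open>The four blocks share their eigenvectors, so one invertible base change makes all of
  them diagonal. Diagonal blocks commute, which reduces the determinant to 2x2 determinants.\<close>

lemma det_block_circulant:
  "det (four_block_mat (circulant n c1) (circulant n c2) (circulant n c3) (circulant n c4)) =
    (\<Prod>j = 0..<n. symbol n c1 j * symbol n c4 j - symbol n c2 j * symbol n c3 j)"
proof -
  let ?F = "mat n n (\<lambda>(i, j). zeta n j ^ i)" and ?C = "circulant n" and ?O = "0\<^sub>m n n :: complex mat"
  let ?D = "\<lambda>c. diagonal_mat_of n (symbol n c)"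
  let ?M = "four_block_mat (?C c1) (?C c2) (?C c3) (?C c4)"
  let ?FF = "four_block_mat ?F ?O ?O ?F"
  let ?DD = "four_block_mat (?D c1) (?D c2) (?D c3) (?D c4)"
  have F: "?F \<in> carrier_mat n n" by simp
  have CF: "?C c * ?F \<in> carrier_mat n n" and FD: "?F * ?D c \<in> carrier_mat n n" for c
    by (rule mult_carrier_mat[of _ n n]; simp)+
  have "?M * ?FF = four_block_mat (?C c1 * ?F) (?C c2 * ?F) (?C c3 * ?F) (?C c4 * ?F)"
    by (subst mult_four_block_mat[where ?nr1.0 = n and ?n1.0 = n and ?n2.0 = n and ?nr2.0 = n and ?nc1.0 = n and ?nc2.0 = n])
      (simp_all add: right_mult_zero_mat[OF circulant_carrier] left_add_zero_mat[OF CF] right_add_zero_mat[OF CF])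
  also have "\<dots> = four_block_mat (?F * ?D c1) (?F * ?D c2) (?F * ?D c3) (?F * ?D c4)"
    unfolding circulant_mult_fourier ..
  also have "\<dots> = ?FF * ?DD"
    by (subst mult_four_block_mat[where ?nr1.0 = n and ?n1.0 = n and ?n2.0 = n and ?nr2.0 = n and ?nc1.0 = n and ?nc2.0 = n])
      (simp_all add: left_mult_zero_mat[OF diagonal_mat_of_carrier] left_add_zero_mat[OF FD] right_add_zero_mat[OF FD])
  finally have "det (?M * ?FF) = det (?FF * ?DD)" by simp
  then have "det ?M * det ?FF = det ?FF * det ?DD"
    by (simp add: det_mult[of _ "n + n"])
  moreover have "det ?FF \<noteq> 0"
    using det_vandermonde_nonzero[OF inj_on_zeta[of n]]
    by (simp add: det_four_block_mat_upper_right_zero[of _ n _ n])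
  ultimately have "det ?M = det ?DD" by simp
  also have "\<dots> = det (?D c1 * ?D c4 - ?D c2 * ?D c3)"
    by (intro det_four_block_mat[of _ n]) (simp_all add: diagonal_mat_of_mult mult.commute)
  also have "?D c1 * ?D c4 - ?D c2 * ?D c3 =
      diagonal_mat_of n (\<lambda>j. symbol n c1 j * symbol n c4 j - symbol n c2 j * symbol n c3 j)"
    unfolding diagonal_mat_of_mult by (auto simp: diagonal_mat_of_def intro!: eq_matI)
  finally show ?thesis by (simp add: det_diagonal_mat_of)
qed

section \<open>Spanning trees of bicirculant graphs\<close>

text \<open>The sum is the eigenvalue of an all-ones block; hence \<open>J\<close> is invisible in
  every mode but \<open>j = 0\<close>.\<close>

lemma sum_root_of_unity_powi:
  assumes "j < n" "j \<noteq> 0"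
  shows "(\<Sum>k\<in>{0..<int n}. zeta n j powi k) = 0"
proof -
  have z: "zeta n j \<noteq> 1" "zeta n j ^ n = 1"
    using assms inj_on_zeta[of n] zeta_power_n[of n j] by (auto dest: inj_onD[of _ _ j 0])
  have "(\<Sum>k\<in>{0..<int n}. zeta n j powi k) = (\<Sum>h = 0..<n. zeta n j powi int h)"
    by (rule sum.reindex_bij_witness[of _ int nat]) auto
  also have "\<dots> = 0" using z by (simp add: atLeast0LessThan sum_gp_strict)
  finally show ?thesis .
qed

locale bicirculant =
  fixes n :: nat and R T S :: "int set"
  assumes n_pos: "n > 0"
    and R: "R \<subseteq> {0<..<int n}" "\<And>k. k \<in> R \<Longrightarrow> (- k) mod int n \<in> R"
    and T: "T \<subseteq> {0<..<int n}" "\<And>k. k \<in> T \<Longrightarrow> (- k) mod int n \<in> T"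
    and S: "S \<subseteq> {0..<int n}"
begin

lemma neg_residue: "(g - h) mod int n \<in> R \<longleftrightarrow> (h - g) mod int n \<in> R"
  "(g - h) mod int n \<in> T \<longleftrightarrow> (h - g) mod int n \<in> T"
  using R(2)[of "(g - h) mod int n"] R(2)[of "(h - g) mod int n"]
    T(2)[of "(g - h) mod int n"] T(2)[of "(h - g) mod int n"]
  by (auto simp: mod_minus_eq)

text \<open>The last case keeps the difference in the form column minus row that
  \<open>circulant\<close> expects, hence the negation before membership in \<open>S\<close> is
  tested.\<close>

lemma edge_iff:
  assumes "h \<in> {0..<int n}" "g \<in> {0..<int n}"
  shows "{(h, 0), (g, 0)} \<in> snd (BC n R T S) \<longleftrightarrow> (g - h) mod int n \<in> R"
    and "{(h, Suc 0), (g, Suc 0)} \<in> snd (BC n R T S) \<longleftrightarrow> (g - h) mod int n \<in> T"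
    and "{(h, 0), (g, Suc 0)} \<in> snd (BC n R T S) \<longleftrightarrow> (g - h) mod int n \<in> S"
    and "{(h, Suc 0), (g, 0)} \<in> snd (BC n R T S) \<longleftrightarrow> (- ((g - h) mod int n)) mod int n \<in> S"
  using assms neg_residue[of g h] by (auto simp: BC_def doubleton_eq_iff mod_minus_eq)

lemma edges_proper:
  assumes "e \<in> snd (BC n R T S)"
  shows "\<exists>u\<in>fst (BC n R T S). \<exists>w\<in>fst (BC n R T S). e = {u, w} \<and> u \<noteq> w"
proof -
  have "(g - h) mod int n \<noteq> 0" if "(g - h) mod int n \<in> R \<union> T" for g h :: int
    using that R(1) T(1) by auto
  then have ne: "h \<noteq> g" if "(g - h) mod int n \<in> R \<union> T" for g h :: int
    using that by (metis diff_self mod_0)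
  consider h g where "h \<in> {0..<int n}" "g \<in> {0..<int n}" "(g - h) mod int n \<in> R" "e = {(h, 0), (g, 0)}"
    | h g where "h \<in> {0..<int n}" "g \<in> {0..<int n}" "(g - h) mod int n \<in> T" "e = {(h, 1), (g, 1)}"
    | h g where "h \<in> {0..<int n}" "g \<in> {0..<int n}" "(g - h) mod int n \<in> S" "e = {(h, 0), (g, 1)}"
    using assms unfolding BC_def by auto
  then show ?thesis
  proof cases
    case 1
    with ne[of g h] have "(h, 0) \<in> fst (BC n R T S)" "(g, 0) \<in> fst (BC n R T S)" "(h, 0 :: nat) \<noteq> (g, 0)"
      by (auto simp: BC_def)
    then show ?thesis using 1(4) by blast
  next
    case 2
    with ne[of g h] have "(h, 1) \<in> fst (BC n R T S)" "(g, 1) \<in> fst (BC n R T S)" "(h, 1 :: nat) \<noteq> (g, 1)"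
      by (auto simp: BC_def)
    then show ?thesis using 2(4) by blast
  next
    case 3
    then have "(h, 0) \<in> fst (BC n R T S)" "(g, 1) \<in> fst (BC n R T S)" "(h, 0 :: nat) \<noteq> (g, 1)"
      by (auto simp: BC_def)
    then show ?thesis using 3(4) by blast
  qed
qed

text \<open>Listing layer 0 before layer 1 gives the Laplacian its 2x2 block form.\<close>

definition vertex :: "nat \<Rightarrow> int \<times> nat" where
  "vertex i = (if i < n then (int i, 0) else (int i - int n, 1))"

lemma bij_betw_vertex: "bij_betw vertex {0..<n + n} (fst (BC n R T S))"
proof (rule bij_betwI[of _ _ _ "\<lambda>(h, b). nat h + b * n"])
  show "vertex \<in> {0..<n + n} \<rightarrow> fst (BC n R T S)" by (auto simp: vertex_def BC_def)
qed (auto simp: vertex_def BC_def)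

lemma card_residues:
  assumes "A \<subseteq> {0..<int n}"
  shows "card {h. h < n \<and> (int h - a) mod int n \<in> A} = card A"
proof -
  note b = bij_betw_residue_shift[OF n_pos, of a]
  let ?f = "\<lambda>h. (int h - a) mod int n" and ?B = "{h. h < n \<and> (int h - a) mod int n \<in> A}"
  have "A \<subseteq> ?f ` ?B"
  proof
    fix x assume x: "x \<in> A"
    then have "x \<in> ?f ` {0..<n}" using b assms by (auto simp: bij_betw_def)
    then show "x \<in> ?f ` ?B" using x by auto
  qed
  then have "?f ` ?B = A" by auto
  moreover have "inj_on ?f ?B" using b by (auto simp: bij_betw_def intro: inj_on_subset)
  ultimately have "bij_betw ?f ?B A" by (simp add: bij_betw_def)
  then show ?thesis by (rule bij_betw_same_card)
qed

lemma card_residues_neg: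
  assumes "A \<subseteq> {0..<int n}"
  shows "card {h. h < n \<and> (- ((int h - a) mod int n)) mod int n \<in> A} = card A"
proof -
  let ?f = "\<lambda>x. (- x) mod int n"
  let ?A = "{x\<in>{0..<int n}. ?f x \<in> A}"
  have "bij_betw ?f ?A A"
    using assms n_pos by (intro bij_betwI[of _ _ _ ?f]) (auto simp: mod_minus_eq)
  then have "card ?A = card A" by (rule bij_betw_same_card)
  moreover have "{h. h < n \<and> (- ((int h - a) mod int n)) mod int n \<in> A} =
      {h. h < n \<and> (int h - a) mod int n \<in> ?A}" using n_pos by auto
  moreover have "card {h. h < n \<and> (int h - a) mod int n \<in> ?A} = card ?A"
    by (rule card_residues) auto
  ultimately show ?thesis by (simp only:)
qed

lemma degree_vertex:
  assumes i: "i < n + n"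
  shows "card {h. h < n + n \<and> {vertex i, vertex h} \<in> snd (BC n R T S)} =
    (if i < n then card R else card T) + card S"
proof -
  let ?P = "\<lambda>h. {vertex i, vertex h} \<in> snd (BC n R T S)"
  have RT: "R \<subseteq> {0..<int n}" "T \<subseteq> {0..<int n}" using R(1) T(1) by auto
  define L where "L = {h. h < n \<and> ?P h}"
  define U where "U = {h. h < n \<and> ?P (h + n)}"
  have split: "{h. h < n + n \<and> ?P h} = L \<union> (\<lambda>h. h + n) ` U"
  proof (intro equalityI subsetI)
    fix h assume h: "h \<in> {h. h < n + n \<and> ?P h}"
    then show "h \<in> L \<union> (\<lambda>h. h + n) ` U"
    proof (cases "h < n")
      case False
      then obtain g where "h = g + n" by (metis add.commute le_Suc_ex not_less)
      with h have "g \<in> U" by (simp add: U_def)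
      then show ?thesis unfolding \<open>h = g + n\<close> by (rule UnI2[OF imageI])
    qed (use h in \<open>auto simp: L_def\<close>)
  qed (auto simp: L_def U_def)
  have "card (L \<union> (\<lambda>h. h + n) ` U) = card L + card ((\<lambda>h. h + n) ` U)"
    by (rule card_Un_disjoint) (auto simp: L_def U_def)
  moreover have "card ((\<lambda>h. h + n) ` U) = card U" by (rule card_image) simp
  moreover have "card L + card U = (if i < n then card R else card T) + card S"
  proof (cases "i < n")
    case True
    have "L = {h. h < n \<and> (int h - int i) mod int n \<in> R}"
      "U = {h. h < n \<and> (int h - int i) mod int n \<in> S}"
      using True edge_iff by (auto simp: vertex_def L_def U_def)
    then show ?thesis using True card_residues[OF RT(1)] card_residues[OF S] by simp
  next
    case False
    have "L = {h. h < n \<and> (- ((int h - (int i - int n)) mod int n)) mod int n \<in> S}"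
      "U = {h. h < n \<and> (int h - (int i - int n)) mod int n \<in> T}"
      using False i edge_iff[of "int i - int n"] by (auto simp: vertex_def L_def U_def)
    then show ?thesis using False card_residues[OF RT(2)] card_residues_neg[OF S] by simp
  qed
  ultimately show ?thesis unfolding split by simp
qed

text \<open>The four functions generate the circulant blocks of L + J. The final \<open>+ 1\<close>
  comes from J, \<open>card R + card S\<close> is the degree in layer 0, and \<open>c_S'\<close>
  belongs to the transpose of the block of \<open>c_S\<close>.\<close>

definition c_R :: "int \<Rightarrow> complex" where
  "c_R k = (if k = 0 then of_nat (card R + card S) else 0) - (if k \<in> R then 1 else 0) + 1"

definition c_T :: "int \<Rightarrow> complex" where
  "c_T k = (if k = 0 then of_nat (card T + card S) else 0) - (if k \<in> T then 1 else 0) + 1"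

definition c_S :: "int \<Rightarrow> complex" where
  "c_S k = - (if k \<in> S then 1 else 0) + 1"

definition c_S' :: "int \<Rightarrow> complex" where
  "c_S' k = - (if (- k) mod int n \<in> S then 1 else 0) + 1"

lemma laplacian_add_ones_blocks:
  "mat (n + n) (n + n) (\<lambda>(i, j).
      (if i = j then of_nat (card {h. h < n + n \<and> {vertex i, vertex h} \<in> snd (BC n R T S)})
       else if {vertex i, vertex j} \<in> snd (BC n R T S) then -1 else 0) + 1) =
    four_block_mat (circulant n c_R) (circulant n c_S) (circulant n c_S') (circulant n c_T)"
  (is "?L = ?B")
proof (rule eq_matI)
  fix i j assume "i < dim_row ?B" "j < dim_col ?B"
  then have ij: "i < n + n" "j < n + n" by (auto simp: circulant_def)
  have zero: "0 \<notin> R" "0 \<notin> T" using R(1) T(1) by auto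
  have mod0: "(int b - int a) mod int n = 0 \<longleftrightarrow> a = b" if "a < n" "b < n" for a b
    using inj_onD[OF bij_betw_imp_inj_on[OF bij_betw_residue_shift[OF n_pos, of "int a"]], of a b] that by auto
  have edge: "{vertex i, vertex j} \<in> snd (BC n R T S) \<longleftrightarrow>
      (if i < n then if j < n then (int j - int i) mod int n \<in> R else (int j - int n - int i) mod int n \<in> S
       else if j < n then (- ((int j - (int i - int n)) mod int n)) mod int n \<in> S
       else (int j - int n - (int i - int n)) mod int n \<in> T)"
    using ij by (auto simp: vertex_def edge_iff)
  have B: "?B $$ (i, j) = (if i < n then if j < n then c_R ((int j - int i) mod int n)
         else c_S ((int (j - n) - int i) mod int n)
       else if j < n then c_S' ((int j - int (i - n)) mod int n)
       else c_T ((int (j - n) - int (i - n)) mod int n))"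
    using ij by (simp add: circulant_def)
  have dvd: "int n dvd int j - int i \<longleftrightarrow> i = j" if "\<not> i < n" "\<not> j < n"
    using mod0[of "i - n" "j - n"] that ij by (auto simp: of_nat_diff mod_eq_0_iff_dvd)
  show "?L $$ (i, j) = ?B $$ (i, j)"
    unfolding B using ij degree_vertex[OF ij(1)] edge zero mod0[of i j] dvd
    by (auto simp: c_R_def c_S_def c_S'_def c_T_def of_nat_diff)
qed (auto simp: circulant_def)

lemma sum_residues_if:
  assumes "A \<subseteq> {0..<int n}"
  shows "(\<Sum>k\<in>{0..<int n}. (if k \<in> A then 1 else 0) * f k) = (\<Sum>k\<in>A. f k :: complex)"
  using assms by (intro sum.mono_neutral_cong_right) auto

lemma symbol_diagonal:
  assumes A: "A \<subseteq> {0..<int n}"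
  shows "symbol n (\<lambda>k. (if k = 0 then d else 0) - (if k \<in> A then 1 else 0) + 1) j =
    d - (\<Sum>k\<in>A. zeta n j powi k) + (\<Sum>k\<in>{0..<int n}. zeta n j powi k)"
proof -
  have "(\<Sum>k\<in>{0..<int n}. (if k = 0 then d else 0) * zeta n j powi k) =
      (\<Sum>k\<in>{0..<int n}. if k = 0 then d else 0)"
    by (intro sum.cong) auto
  also have "\<dots> = d" using n_pos by simp
  finally show ?thesis
    unfolding symbol_def ring_distribs sum.distrib sum_subtractf left_diff_distrib sum_residues_if[OF A]
    by simp
qed

lemma symbol_c_S':
  "symbol n c_S' j = - (\<Sum>k\<in>S. zeta n j powi (- k)) + (\<Sum>k\<in>{0..<int n}. zeta n j powi k)"
proof -
  let ?f = "\<lambda>x. (- x) mod int n"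
  let ?A = "{x\<in>{0..<int n}. ?f x \<in> S}"
  have "symbol n c_S' j = symbol n (\<lambda>k. (if k = 0 then 0 else 0) - (if k \<in> ?A then 1 else 0) + 1) j"
    unfolding symbol_def c_S'_def by (intro sum.cong) auto
  also have "\<dots> = - (\<Sum>k\<in>?A. zeta n j powi k) + (\<Sum>k\<in>{0..<int n}. zeta n j powi k)"
    by (subst symbol_diagonal) auto
  also have "(\<Sum>k\<in>?A. zeta n j powi k) = (\<Sum>k\<in>S. zeta n j powi (- k))"
    using S n_pos by (intro sum.reindex_bij_witness[of _ ?f ?f])
      (auto simp: mod_minus_eq power_int_mod zeta_power_n power_int_minus)
  finally show ?thesis .
qed

text \<open>The 2x2 determinant in mode \<open>j\<close> for L alone, without J.\<close>

definition symbol_det :: "nat \<Rightarrow> complex" where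
  "symbol_det j =
    (of_nat (card R + card S) - (\<Sum>k\<in>R. zeta n j powi k)) *
    (of_nat (card T + card S) - (\<Sum>k\<in>T. zeta n j powi k)) -
    (\<Sum>k\<in>S. zeta n j powi k) * (\<Sum>k\<in>S. zeta n j powi (- k))"

lemma spanning_tree_count_BC:
  "of_nat n * of_nat (\<tau> (BC n R T S)) = of_nat (card S) * (\<Prod>j = 1..<n. symbol_det j)"
proof -
  have RT: "R \<subseteq> {0..<int n}" "T \<subseteq> {0..<int n}" using R(1) T(1) by auto
  let ?one = "\<lambda>j. \<Sum>k\<in>{0..<int n}. zeta n j powi k"
  have sym: "symbol n c_R j = of_nat (card R + card S) - (\<Sum>k\<in>R. zeta n j powi k) + ?one j"
    "symbol n c_T j = of_nat (card T + card S) - (\<Sum>k\<in>T. zeta n j powi k) + ?one j"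
    "symbol n c_S j = - (\<Sum>k\<in>S. zeta n j powi k) + ?one j" for j
    using symbol_diagonal[OF RT(1), of "of_nat (card R + card S)" j]
      symbol_diagonal[OF RT(2), of "of_nat (card T + card S)" j]
      symbol_diagonal[OF S, of 0 j] unfolding c_R_def c_T_def c_S_def by simp_all
  let ?g = "\<lambda>j. symbol n c_R j * symbol n c_T j - symbol n c_S j * symbol n c_S' j"
  \<comment> \<open>In mode 0 both diagonal entries are \<open>card S + n\<close> and both others
    \<open>n - card S\<close>; the difference of squares is four times the product.\<close>
  have g0: "?g 0 = 4 * of_nat (card S) * of_nat n"
    unfolding sym symbol_c_S' by (simp add: algebra_simps)
  have g: "?g j = symbol_det j" if "j \<in> {1..<n}" for j
    unfolding sym symbol_c_S' symbol_det_def using that sum_root_of_unity_powi[of j n] by simp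
  have "(of_nat (n + n))\<^sup>2 * of_nat (\<tau> (BC n R T S)) = (\<Prod>j = 0..<n. ?g j)"
    using matrix_tree_add_ones[where E = "snd (BC n R T S)" and ?'a = complex,
        OF bij_betw_vertex _ edges_proper] n_pos
    unfolding laplacian_add_ones_blocks det_block_circulant by simp
  also have "\<dots> = ?g 0 * (\<Prod>j = 1..<n. ?g j)"
    using n_pos by (subst prod.atLeast_Suc_lessThan) auto
  also have "(\<Prod>j = 1..<n. ?g j) = (\<Prod>j = 1..<n. symbol_det j)"
    by (intro prod.cong refl g)
  finally have "4 * of_nat n * (of_nat n * of_nat (\<tau> (BC n R T S))) =
      4 * of_nat n * (of_nat (card S) * (\<Prod>j = 1..<n. symbol_det j))"
    unfolding g0 by (simp add: power2_eq_square algebra_simps)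
  then show ?thesis using n_pos by simp
qed

end

section \<open>Products of integer polynomials over conjugate cosines\<close>

text \<open>Leading terms cancel, so the difference would have more roots than its degree
  allows.\<close>

lemma monic_poly_eq_prod_roots:
  fixes g :: "'a :: idom poly"
  assumes g: "lead_coeff g = 1" and X: "finite X" "card X = degree g"
    and roots: "\<And>x. x \<in> X \<Longrightarrow> poly g x = 0"
  shows "g = (\<Prod>x\<in>X. [:- x, 1:])"
proof (rule ccontr)
  let ?P = "\<Prod>x\<in>X. [:- x, 1:]"
  assume "g \<noteq> ?P"
  then have ne: "g - ?P \<noteq> 0" by simp
  have dP: "degree ?P = degree g"
    using X by (subst degree_prod_eq_sum_degree) auto
  have lP: "lead_coeff ?P = 1" by (simp add: lead_coeff_prod)
  have "degree g \<noteq> 0"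
  proof
    assume "degree g = 0"
    then have "g = 1" using g by (auto elim!: degree_eq_zeroE)
    moreover have "X = {}" using X \<open>degree g = 0\<close> by simp
    ultimately show False using \<open>g \<noteq> ?P\<close> by simp
  qed
  moreover have "degree (g - ?P) \<le> degree g" using dP by (intro degree_diff_le) auto
  moreover have "coeff (g - ?P) (degree g) = 0" using g lP dP by simp
  ultimately have "degree (g - ?P) < degree g"
    using ne by (metis le_neq_implies_less leading_coeff_0_iff)
  moreover have "card X \<le> card {x. poly (g - ?P) x = 0}"
    using roots X by (intro card_mono poly_roots_finite[OF ne]) (auto simp: poly_prod)
  moreover have "card {x. poly (g - ?P) x = 0} \<le> degree (g - ?P)"
    by (rule card_poly_roots_bound[OF ne])
  ultimately show False using X by simp
qed

text \<open>Multiplication by \<open>q\<close> on \<open>\<int>[x] / (g)\<close> has an integer matrix, and it is diagonalised by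
  the Vandermonde matrix of the roots of \<open>g\<close>.\<close>

lemma prod_over_roots_integer:
  fixes g q :: "int poly" and X :: "complex set"
  assumes g: "lead_coeff g = 1" and X: "finite X" "card X = degree g"
    and roots: "\<And>x. x \<in> X \<Longrightarrow> poly (map_poly of_int g) x = 0"
  shows "\<exists>c::int. (\<Prod>x\<in>X. poly (map_poly of_int q) x) = of_int c"
proof -
  define k where "k = degree g"
  obtain x where x: "bij_betw x {0..<k} X"
    using ex_bij_betw_nat_finite[OF X(1)] X(2) unfolding k_def by auto
  have gx: "poly (map_poly of_int g) (x j) = 0" if "j < k" for j
    using roots x that unfolding bij_betw_def by auto
  \<comment> \<open>Remainders of \<open>monom 1 i * q\<close>; as \<open>g\<close> is monic,
    pseudo-division is true division. Their coefficients form the rows of the multiplication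
    matrix.\<close>
  define r where "r i = pseudo_mod (monom 1 i * q) g" for i
  have g0: "g \<noteq> 0" using g by auto
  have r_deg: "r i = 0 \<or> degree (r i) < k" for i
    using pseudo_mod(2)[OF g0, of "monom 1 i * q"] unfolding r_def k_def by auto
  have r_eval: "poly (map_poly of_int (r i)) (x j) = x j ^ i * poly (map_poly of_int q) (x j)"
    if j: "j < k" for i j
  proof -
    obtain s where "pseudo_divmod (monom 1 i * q) g = (s, r i)"
      unfolding r_def pseudo_mod_def by (cases "pseudo_divmod (monom 1 i * q) g") auto
    from pseudo_divmod(1)[OF g0 this] have "monom 1 i * q = g * s + r i" using g by simp
    then have "poly (map_poly of_int (monom 1 i * q)) (x j) =
        poly (map_poly of_int (g * s + r i)) (x j)" by (rule arg_cong)
    then show ?thesis using gx[OF j]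
      by (simp add: of_int_poly_hom.hom_mult of_int_poly_hom.hom_add poly_monom map_poly_monom)
  qed
  let ?N = "mat k k (\<lambda>(i, h). coeff (r i) h)"
  let ?V = "mat k k (\<lambda>(i, j). x j ^ i)"
  let ?q = "\<lambda>j. poly (map_poly of_int q) (x j)"
  have "map_mat of_int ?N * ?V = ?V * diagonal_mat_of k ?q"
    unfolding mult_diagonal_mat_of_right[of ?V k, OF mat_carrier]
  proof (rule eq_matI)
    fix i j assume "i < dim_row (mat k k (\<lambda>(i, j). ?V $$ (i, j) * ?q j))"
      "j < dim_col (mat k k (\<lambda>(i, j). ?V $$ (i, j) * ?q j))"
    then have ij: "i < k" "j < k" by auto
    have "(map_mat of_int ?N * ?V) $$ (i, j) = (\<Sum>h = 0..<k. map_mat of_int ?N $$ (i, h) * ?V $$ (h, j))"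
      using ij by (intro index_mult_mat_sum) auto
    also have "\<dots> = (\<Sum>h = 0..<k. of_int (coeff (r i) h) * x j ^ h)"
      using ij by (intro sum.cong) auto
    also have "\<dots> = (\<Sum>h\<le>degree (map_poly of_int (r i) :: complex poly). of_int (coeff (r i) h) * x j ^ h)"
    proof (rule sum.mono_neutral_right)
      show "{..degree (map_poly of_int (r i) :: complex poly)} \<subseteq> {0..<k}"
        using r_deg[of i] ij by auto
      show "\<forall>h\<in>{0..<k} - {..degree (map_poly of_int (r i) :: complex poly)}.
          of_int (coeff (r i) h) * x j ^ h = 0"
        by (auto simp: coeff_eq_0)
    qed simp
    also have "\<dots> = poly (map_poly of_int (r i)) (x j)"
      by (simp add: poly_altdef)
    finally show "(map_mat of_int ?N * ?V) $$ (i, j) = mat k k (\<lambda>(i, j). ?V $$ (i, j) * ?q j) $$ (i, j)"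
      using ij r_eval[OF ij(2)] by simp
  qed auto
  then have "det (map_mat of_int ?N * ?V) = det (?V * diagonal_mat_of k ?q)" by simp
  then have "of_int (det ?N) * det ?V = det ?V * (\<Prod>j = 0..<k. ?q j)"
    by (simp add: det_mult[of _ k] det_diagonal_mat_of)
  moreover have "det ?V \<noteq> 0" using det_vandermonde_nonzero[of x k] x unfolding bij_betw_def by blast
  moreover have "(\<Prod>j = 0..<k. ?q j) = (\<Prod>x\<in>X. poly (map_poly of_int q) x)"
    by (rule prod.reindex_bij_betw[OF x])
  ultimately show ?thesis by (intro exI[of _ "det ?N"]) simp
qed

section \<open>Chebyshev polynomials and symmetric Laurent polynomials\<close>

text \<open>With U the Chebyshev polynomials of the second kind, \<open>cheb k\<close> is
  U_(k-1)(x/2). The rescaling makes it monic, and the shift of the index makes \<open>cheb 0\<close>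
  vanish.\<close>

fun cheb :: "nat \<Rightarrow> int poly" where
  "cheb 0 = 0"
| "cheb (Suc 0) = 1"
| "cheb (Suc (Suc k)) = [:0, 1:] * cheb (Suc k) - cheb k"

text \<open>A symmetric Laurent polynomial is carried as an integer polynomial in
  \<open>z + inverse z\<close>; \<open>ev\<close> evaluates it at \<open>z\<close> again.\<close>

definition ev :: "int poly \<Rightarrow> complex \<Rightarrow> complex" where
  "ev p z = poly (map_poly of_int p) (z + inverse z)"

lemma ev_pCons [simp]: "ev (pCons a p) z = of_int a + (z + inverse z) * ev p z"
  by (simp add: ev_def of_int_hom.map_poly_pCons_hom)

lemma ev_0 [simp]: "ev 0 z = 0"
  by (simp add: ev_def)

lemma ev_const [simp]: "ev 1 z = 1" "ev (of_nat i) z = of_nat i" "ev (numeral m) z = numeral m"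
  by (simp_all add: one_pCons of_nat_poly numeral_poly)

lemma ev_arith [simp]:
  "ev (p + q) z = ev p z + ev q z" "ev (p - q) z = ev p z - ev q z" "ev (p * q) z = ev p z * ev q z"
  by (simp_all add: ev_def of_int_poly_hom.hom_mult of_int_poly_hom.hom_add of_int_poly_hom.hom_minus)

text \<open>The quotient formula of Chebyshev polynomials, multiplied out so that it also covers z =
  1 and z = -1.\<close>

lemma ev_cheb:
  assumes "z \<noteq> 0"
  shows "ev (cheb k) z * (z - inverse z) = z ^ k - inverse z ^ k"
proof (induction k rule: cheb.induct)
  case (3 k)
  have "ev (cheb (Suc (Suc k))) z * (z - inverse z) =
      (z + inverse z) * (ev (cheb (Suc k)) z * (z - inverse z)) - ev (cheb k) z * (z - inverse z)"
    by (simp add: algebra_simps)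
  also have "\<dots> =
      (z + inverse z) * (z ^ Suc k - inverse z ^ Suc k) - (z ^ k - inverse z ^ k)"
    unfolding 3 ..
  also have "\<dots> = z ^ Suc (Suc k) - inverse z ^ Suc (Suc k)"
  proof -
    have [simp]: "z * (inverse z * w) = w" for w using assms by (simp flip: mult.assoc)
    show ?thesis by (simp add: algebra_simps)
  qed
  finally show ?case .
qed simp_all

lemma degree_cheb_Suc: "degree (cheb (Suc k)) = k \<and> lead_coeff (cheb (Suc k)) = 1"
proof (induction k rule: less_induct)
  case (less k)
  consider "k = 0" | "k = 1" | l where "k = Suc (Suc l)" by (metis One_nat_def not0_implies_Suc)
  then show ?case
  proof cases
    case 3
    have 1: "degree (cheb (Suc (Suc l))) = Suc l" "lead_coeff (cheb (Suc (Suc l))) = 1"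
      "degree (cheb (Suc l)) = l" using less.IH[of "Suc l"] less.IH[of l] 3 by auto
    let ?p = "pCons 0 (cheb (Suc (Suc l)))"
    have c: "cheb (Suc k) = ?p - cheb (Suc l)" by (simp add: 3)
    have d: "degree ?p = k" using 1 3 by (auto simp: degree_pCons_eq_if)
    have "degree (?p + - cheb (Suc l)) = k" using d 1 3
      by (subst degree_add_eq_left) auto
    then have "degree (cheb (Suc k)) = k" unfolding c by simp
    moreover have "coeff (cheb (Suc k)) k = 1"
      unfolding c using 1 3 by (simp add: coeff_eq_0)
    ultimately show ?thesis by simp
  qed simp_all
qed

lemma degree_cheb: "degree (cheb k) \<le> k - 1"
  using degree_cheb_Suc[of "k - 1"] by (cases k) auto

lemma monic_cheb_plus:
  assumes "degree p < k"
  shows "degree (cheb (Suc k) + p) = k" "lead_coeff (cheb (Suc k) + p) = 1"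
    "degree (cheb (Suc k) - p) = k" "lead_coeff (cheb (Suc k) - p) = 1"
proof -
  have *: "degree (cheb (Suc k) + r) = k \<and> lead_coeff (cheb (Suc k) + r) = 1" if "degree r < k" for r
    using degree_cheb_Suc[of k] that by (auto simp: degree_add_eq_left coeff_eq_0)
  show "degree (cheb (Suc k) + p) = k" "lead_coeff (cheb (Suc k) + p) = 1"
    using *[of p] assms by auto
  show "degree (cheb (Suc k) - p) = k" "lead_coeff (cheb (Suc k) - p) = 1"
    using *[of "- p"] assms by auto
qed

text \<open>The argument 2 corresponds to z = 1. These values are the source of the factor n or n/2
  in the half products.\<close>

lemma poly_cheb_2: "poly (cheb k) 2 = int k"
  by (induction k rule: cheb.induct) simp_all

text \<open>These are Dickson polynomials: the recursion of \<open>cheb\<close> started with 2 and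
  x.\<close>

lemma power_sum_ev: "\<exists>p. \<forall>z. z \<noteq> 0 \<longrightarrow> ev p z = z powi k + z powi (- k)"
proof -
  have nat: "\<exists>p. \<forall>z. z \<noteq> 0 \<longrightarrow> ev p z = z ^ n + inverse z ^ n" for n
  proof (induction n rule: induct_nat_012)
    case 0
    show ?case by (intro exI[of _ 2]) simp
  next
    case 1
    show ?case by (intro exI[of _ "[:0, 1:]"]) simp
  next
    case (ge2 n)
    then obtain p p' where p: "\<And>z. z \<noteq> 0 \<Longrightarrow> ev p z = z ^ n + inverse z ^ n"
      "\<And>z. z \<noteq> 0 \<Longrightarrow> ev p' z = z ^ Suc n + inverse z ^ Suc n" by blast
    have [simp]: "z * (inverse z * w) = w" if "z \<noteq> 0" for z w :: complex
      using that by (simp flip: mult.assoc)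
    show ?case
      by (intro exI[of _ "[:0, 1:] * p' - p"]) (simp add: p algebra_simps)
  qed
  obtain p where p: "\<And>z. z \<noteq> 0 \<Longrightarrow> ev p z = z ^ nat \<bar>k\<bar> + inverse z ^ nat \<bar>k\<bar>" using nat by blast
  show ?thesis
    by (intro exI[of _ p]) (auto simp: p power_int_def power_inverse)
qed

lemma zeta_plus_inverse: "zeta n j + inverse (zeta n j) = of_real (2 * cos (2 * pi * real j / real n))"
  by (simp add: zeta_def complex_eq_iff flip: cis_cnj) 

text \<open>Up to half a period the angles lie in [0, pi], where the cosine is injective. A product
  over such indices is thus a product over distinct roots.\<close>

lemma inj_on_zeta_plus_inverse:
  assumes "n > 0"
  shows "inj_on (\<lambda>j. zeta n j + inverse (zeta n j)) {j. 2 * j \<le> n}"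
proof (rule inj_onI)
  fix i j assume ij: "i \<in> {j. 2 * j \<le> n}" "j \<in> {j. 2 * j \<le> n}"
    and eq: "zeta n i + inverse (zeta n i) = zeta n j + inverse (zeta n j)"
  have "2 * pi * real l / real n \<in> {0..pi}" if l: "l \<in> {j. 2 * j \<le> n}" for l
  proof -
    have "pi * (2 * real l) \<le> pi * real n" using l by (intro mult_left_mono) auto
    then show ?thesis using assms by (simp add: field_simps)
  qed
  moreover have "cos (2 * pi * real i / real n) = cos (2 * pi * real j / real n)"
    using eq unfolding zeta_plus_inverse of_real_eq_iff by simp
  ultimately have "2 * pi * real i / real n = 2 * pi * real j / real n"
    using ij cos_inj_pi by (metis atLeastAtMost_iff)
  then show "i = j" using assms by simp
qed

text \<open>The degree condition makes the values \<open>zeta n j + inverse (zeta n j)\<close> all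
  the roots of \<open>g\<close>. The first product is then a norm from the quotient by
  \<open>g\<close>, and the second is \<open>g\<close> at 2.\<close>

lemma prod_ev_zeta_integer:
  assumes n: "n > 0" and J: "J \<subseteq> {j. 2 * j \<le> n}"
    and g: "lead_coeff g = 1" "degree g = card J"
    and roots: "\<And>j. j \<in> J \<Longrightarrow> ev g (zeta n j) = 0"
  shows "\<exists>c::int. (\<Prod>j\<in>J. ev q (zeta n j)) = of_int c"
    and "(\<Prod>j\<in>J. 2 - (zeta n j + inverse (zeta n j))) = of_int (poly g 2)"
proof -
  let ?f = "\<lambda>j. zeta n j + inverse (zeta n j)"
  have inj: "inj_on ?f J" by (rule inj_on_subset[OF inj_on_zeta_plus_inverse[OF n] J])
  have "finite J" using J by (rule finite_subset) (rule finite_subset[of _ "{..n}"], auto)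
  have X: "finite (?f ` J)" "card (?f ` J) = degree g" using \<open>finite J\<close> inj g by (auto simp: card_image)
  have roots': "poly (map_poly of_int g) x = 0" if "x \<in> ?f ` J" for x
    using that roots by (auto simp: ev_def)
  show "\<exists>c::int. (\<Prod>j\<in>J. ev q (zeta n j)) = of_int c"
    using prod_over_roots_integer[OF g(1) X roots', of q] by (simp add: prod.reindex[OF inj] ev_def)
  have "map_poly of_int g = (\<Prod>x\<in>?f ` J. [:- x, 1:])"
    using g(1) X roots' by (intro monic_poly_eq_prod_roots) auto
  then have "poly (map_poly of_int g) (2 :: complex) = poly (\<Prod>x\<in>?f ` J. [:- x, 1:]) 2" by simp
  also have "poly (map_poly of_int g) (2 :: complex) = of_int (poly g 2)"
    using of_int_hom.poly_map_poly[of g 2] by simp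
  finally show "(\<Prod>j\<in>J. 2 - ?f j) = of_int (poly g 2)"
    by (simp add: poly_prod prod.reindex[OF inj] algebra_simps)
qed

lemma zeta_power: "zeta n j ^ k = zeta n (j * k)"
  by (simp add: zeta_def DeMoivre algebra_simps)

lemma zeta_reflect:
  assumes "j \<le> n" "n > 0"
  shows "zeta n (n - j) = inverse (zeta n j)"
proof -
  have "zeta n (n - j) * zeta n j = zeta n n"
    using assms by (simp add: zeta_def cis_mult of_nat_diff field_simps)
  also have "\<dots> = 1" using assms by (simp add: zeta_def cis_2pi)
  finally show ?thesis by (simp add: field_simps)
qed

lemma ev_inverse: "ev p (inverse z) = ev p z"
  by (simp add: ev_def add.commute)

lemma ev_1: "ev p 1 = of_int (poly p 2)"
  using of_int_hom.poly_map_poly[of p 2] by (simp add: ev_def)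

lemma ev_minus_1: "ev p (- 1) = of_int (poly p (- 2))"
  using of_int_hom.poly_map_poly[of p "- 2"] by (simp add: ev_def)

text \<open>Strictly inside the half period z is neither 1 nor -1, so the factor
  \<open>z - inverse z\<close> in \<open>ev_cheb\<close> can be cancelled.\<close>

lemma zeta_minus_inverse_nonzero:
  assumes "0 < j" "2 * j < n"
  shows "zeta n j - inverse (zeta n j) \<noteq> 0"
proof
  assume "zeta n j - inverse (zeta n j) = 0"
  then have "zeta n j ^ 2 = 1" by (simp add: power2_eq_square field_simps)
  then have "zeta n (2 * j) = zeta n 0" by (simp add: zeta_power mult.commute)
  then show False using inj_onD[OF inj_on_zeta, of n "2 * j" 0] assms by auto
qed

lemma ev_zeta_eq_0I:
  assumes "0 < j" "2 * j < n" and "ev g (zeta n j) * (zeta n j - inverse (zeta n j)) = 0"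
  shows "ev g (zeta n j) = 0"
  using zeta_minus_inverse_nonzero[OF assms(1,2)] assms(3) by simp

text \<open>Used with \<open>c\<close> equal to 1 or -1, to cancel powers in \<open>ev_cheb\<close>
  whose exponents add up to the period or half of it.\<close>

lemma power_eq_scaled_inverse:
  fixes z :: "'a :: field"
  assumes "z ^ (a + b) = c" "z \<noteq> 0"
  shows "z ^ a = c * inverse z ^ b"
  using assms by (auto simp: power_add power_inverse field_simps)

section \<open>Integrality of products over half a period\<close>

lemma prod_half_period:
  assumes n: "n > 0"
  shows "\<exists>c::int. (\<Prod>j\<in>{1..(n - 1) div 2}. ev q (zeta n j)) = of_int c"
    and "(\<Prod>j\<in>{1..(n - 1) div 2}. 2 - (zeta n j + inverse (zeta n j))) =
      of_nat (if odd n then n else n div 2)"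
proof -
  define K where "K = (n - 1) div 2"
  \<comment> \<open>For \<open>n = 2 * K + 1\<close> the indices of the two \<open>cheb\<close>
    terms add up to \<open>n\<close>, so z^n = 1 makes their closed forms cancel; for even
    \<open>n\<close> it makes z^(n/2) its own inverse. At 2 this gives \<open>K + 1 + K = n\<close>
    or \<open>n div 2\<close>. \<open>K = 0\<close> is set apart because the bound
    \<open>degree (cheb K) < K\<close> fails there.\<close>
  define g where "g = (if odd n then if K = 0 then 1 else cheb (Suc K) + cheb K else cheb (n div 2))"
  have J: "{1..K} \<subseteq> {j. 2 * j \<le> n}" unfolding K_def by auto
  have g_monic: "lead_coeff g = 1" "degree g = card {1..K}"
  proof -
    have "lead_coeff g = 1 \<and> degree g = K"
    proof (cases "odd n")
      case True
      then show ?thesis using monic_cheb_plus[of "cheb K" K] degree_cheb[of K] unfolding g_def by auto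
    next
      case False
      then have "n div 2 = Suc K" using n unfolding K_def by auto
      then show ?thesis using degree_cheb_Suc[of K] False unfolding g_def by auto
    qed
    then show "lead_coeff g = 1" "degree g = card {1..K}" by auto
  qed
  have roots: "ev g (zeta n j) = 0" if j: "j \<in> {1..K}" for j
  proof (rule ev_zeta_eq_0I)
    show "0 < j" "2 * j < n" using j unfolding K_def by auto
    let ?z = "zeta n j"
    have z: "?z ^ n = 1" "?z \<noteq> 0" using zeta_power_n[OF n] by auto
    show "ev g ?z * (?z - inverse ?z) = 0"
    proof (cases "odd n")
      case True
      then have "Suc K + K = n" "K + Suc K = n" unfolding K_def by presburger+
      then have "?z ^ Suc K = 1 * inverse ?z ^ K" "?z ^ K = 1 * inverse ?z ^ Suc K"
        using z by (intro power_eq_scaled_inverse; simp only:)+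
      moreover have "ev g ?z * (?z - inverse ?z) =
          (?z ^ Suc K - inverse ?z ^ Suc K) + (?z ^ K - inverse ?z ^ K)"
        unfolding ev_cheb[OF z(2), symmetric] using True j by (simp add: g_def algebra_simps)
      ultimately show ?thesis by simp
    next
      case False
      then have "n div 2 + n div 2 = n" by auto
      then have "?z ^ (n div 2) = 1 * inverse ?z ^ (n div 2)"
        using z by (intro power_eq_scaled_inverse; simp only:)
      then show ?thesis using ev_cheb[OF z(2), of "n div 2"] False by (simp add: g_def)
    qed
  qed
  show "\<exists>c::int. (\<Prod>j\<in>{1..(n - 1) div 2}. ev q (zeta n j)) = of_int c"
    using prod_ev_zeta_integer(1)[OF n J g_monic roots] unfolding K_def by blast
  have "poly g 2 = int (if odd n then n else n div 2)"
  proof (cases "odd n")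
    case True
    then have "n = Suc (K + K)" unfolding K_def by presburger
    with True show ?thesis unfolding g_def by (auto simp: poly_cheb_2)
  qed (simp add: g_def poly_cheb_2)
  then show "(\<Prod>j\<in>{1..(n - 1) div 2}. 2 - (zeta n j + inverse (zeta n j))) =
      of_nat (if odd n then n else n div 2)"
    using prod_ev_zeta_integer(2)[OF n J g_monic roots] unfolding K_def by simp
qed

lemma card_odd_less: "card {j. j < m \<and> odd j} = m div 2"
proof -
  have "bij_betw (\<lambda>i. 2 * i + 1) {..<m div 2} {j. j < m \<and> odd j}"
    by (rule bij_betwI[of _ _ _ "\<lambda>j. j div 2"]) (auto elim!: oddE)
  then show ?thesis using bij_betw_same_card by fastforce
qed

lemma zeta_odd_power:
  assumes "odd j" "m > 0"
  shows "zeta (2 * m) j ^ m = - 1"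
proof -
  have "zeta (2 * m) j ^ m = cis (pi * real j)"
    using assms(2) by (simp add: zeta_def DeMoivre)
  also have "\<dots> = cis pi ^ j" by (metis DeMoivre mult.commute)
  finally show ?thesis using assms(1) by simp
qed

text \<open>The relation for odd indices is z^m = -1 instead of z^n = 1, so the sum of two
  \<open>cheb\<close> terms becomes a difference.\<close>

lemma prod_odd_half_period:
  assumes m: "m > 0"
  shows "\<exists>c::int. (\<Prod>j\<in>{j. j < m \<and> odd j}. ev q (zeta (2 * m) j)) = of_int c"
proof -
  define k where "k = m div 2"
  \<comment> \<open>The indices are \<open>k + 1\<close> and \<open>k\<close> for
    \<open>m = 2 * k + 1\<close>, and \<open>k + 1\<close> and \<open>k - 1\<close> for
    \<open>m = 2 * k\<close>; they add up to \<open>m\<close> in both cases. The degree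
    \<open>k\<close> is the number of odd indices below \<open>m\<close>.\<close>
  define g where "g = (if k = 0 then 1 else if odd m then cheb (Suc k) - cheb k else cheb (Suc k) - cheb (k - 1))"
  have J: "{j. j < m \<and> odd j} \<subseteq> {j. 2 * j \<le> 2 * m}" by auto
  have g_monic: "lead_coeff g = 1" "degree g = card {j. j < m \<and> odd j}"
  proof -
    have "degree (cheb k) < k" "degree (cheb (k - 1)) < k" if "k \<noteq> 0"
      using degree_cheb[of k] degree_cheb[of "k - 1"] that by auto
    then have "lead_coeff g = 1 \<and> degree g = k"
      using monic_cheb_plus(3,4)[of "cheb k" k] monic_cheb_plus(3,4)[of "cheb (k - 1)" k]
      unfolding g_def by auto
    then show "lead_coeff g = 1" "degree g = card {j. j < m \<and> odd j}"
      unfolding card_odd_less k_def by auto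
  qed
  have roots: "ev g (zeta (2 * m) j) = 0" if j: "j \<in> {j. j < m \<and> odd j}" for j
  proof (rule ev_zeta_eq_0I)
    show "0 < j" "2 * j < 2 * m" using j by (auto elim: oddE)
    then have k0: "k \<noteq> 0" using j unfolding k_def by (auto elim!: oddE)
    let ?z = "zeta (2 * m) j"
    have z: "?z ^ m = - 1" "?z \<noteq> 0" using zeta_odd_power[OF _ m] j by auto
    show "ev g ?z * (?z - inverse ?z) = 0"
    proof (cases "odd m")
      case True
      then have "Suc k + k = m" "k + Suc k = m" unfolding k_def by presburger+
      then have "?z ^ Suc k = (- 1) * inverse ?z ^ k" "?z ^ k = (- 1) * inverse ?z ^ Suc k"
        using z by (intro power_eq_scaled_inverse; simp only:)+
      moreover have "ev g ?z * (?z - inverse ?z) =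
          (?z ^ Suc k - inverse ?z ^ Suc k) - (?z ^ k - inverse ?z ^ k)"
        unfolding ev_cheb[OF z(2), symmetric] using True k0 by (simp add: g_def algebra_simps)
      ultimately show ?thesis by simp
    next
      case False
      then have "Suc k + (k - 1) = m" "(k - 1) + Suc k = m" using k0 unfolding k_def by auto
      then have "?z ^ Suc k = (- 1) * inverse ?z ^ (k - 1)" "?z ^ (k - 1) = (- 1) * inverse ?z ^ Suc k"
        using z by (intro power_eq_scaled_inverse; simp only:)+
      moreover have "ev g ?z * (?z - inverse ?z) =
          (?z ^ Suc k - inverse ?z ^ Suc k) - (?z ^ (k - 1) - inverse ?z ^ (k - 1))"
        unfolding ev_cheb[OF z(2), symmetric] using False k0 by (simp add: g_def algebra_simps)
      ultimately show ?thesis by simp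
    qed
  qed
  show ?thesis using prod_ev_zeta_integer(1)[OF _ J g_monic roots] m by simp
qed

lemma prod_symmetric:
  fixes F :: "nat \<Rightarrow> 'a :: comm_semiring_1"
  assumes n: "n > 0" and F: "\<And>j. 0 < j \<Longrightarrow> j < n \<Longrightarrow> F (n - j) = F j"
  shows "(\<Prod>j = 1..<n. F j) =
    (if odd n then 1 else F (n div 2)) * (\<Prod>j\<in>{1..(n - 1) div 2}. F j)\<^sup>2"
proof -
  define K where "K = (n - 1) div 2"
  let ?U = "{n - K..<n}" and ?M = "if odd n then {} else {n div 2}"
  have nK: "n = (if odd n then 2 * K + 1 else 2 * K + 2)" unfolding K_def using n by presburger
  then have K: "2 * K < n" by presburger
  have M: "?M \<subseteq> {K + 1..<n - K}" "{K + 1..<n - K} \<subseteq> ?M" using nK by (cases "odd n"; fastforce)+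
  then have "{1..<n} = {1..K} \<union> ?U \<union> ?M" using K by fastforce
  then have "(\<Prod>j = 1..<n. F j) = (\<Prod>j\<in>{1..K} \<union> ?U. F j) * (\<Prod>j\<in>?M. F j)"
    by (simp only:, intro prod.union_disjoint) (use M K in \<open>auto split: if_splits\<close>)
  also have "(\<Prod>j\<in>{1..K} \<union> ?U. F j) = (\<Prod>j\<in>{1..K}. F j) * (\<Prod>j\<in>?U. F j)"
    by (intro prod.union_disjoint) (use K in auto)
  also have "(\<Prod>j\<in>?U. F j) = (\<Prod>j\<in>{1..K}. F j)"
    using K F by (intro prod.reindex_bij_witness[of _ "\<lambda>j. n - j" "\<lambda>j. n - j"]) auto
  finally show ?thesis unfolding K_def by (simp add: power2_eq_square mult.commute)
qed

text \<open>If the square part of \<open>4 * x\<close> were odd, 4 would divide the square-free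
  part. So the square part is even, and halving it absorbs the 4.\<close>

lemma square_class_quarter:
  fixes x :: int
  obtains r where "x = squarefree_part (4 * x) * r\<^sup>2"
proof -
  let ?q = "squarefree_part (4 * x)" and ?r = "square_part (4 * x)"
  have d: "4 * x = ?q * ?r\<^sup>2" by (rule squarefree_decompose)
  have "even ?r"
  proof (rule ccontr)
    assume "odd ?r"
    then have "coprime (2 ^ 2) (?r\<^sup>2)" by (intro coprime_power_left_iff[THEN iffD2] disjI1) simp
    moreover have "2 ^ 2 dvd ?q * ?r\<^sup>2" unfolding d[symmetric] by simp
    ultimately have "2 ^ 2 dvd ?q" by (simp only: coprime_dvd_mult_left_iff)
    moreover have "squarefree ?q" by simp
    ultimately have "is_unit (2 :: int)" unfolding squarefree_def by blast
    then show False by simp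
  qed
  then obtain r where "?r = 2 * r" by (elim evenE)
  with d have "x = ?q * r\<^sup>2" by (simp add: power_mult_distrib)
  then show ?thesis by (rule that)
qed

section \<open>Square classes of the products\<close>

lemma ev_minus [simp]: "ev (- p) z = - ev p z"
  by (simp add: ev_def of_int_poly_hom.hom_uminus)

text \<open>A root of \<open>p\<close> at 2 is a double root of \<open>ev p\<close> at z = 1. The
  split-off factor \<open>2 - (z + inverse z)\<close> contributes the known product, the integral
  cofactor contributes \<open>d\<close>.\<close>

lemma prod_half_period_double_root:
  assumes p: "poly p 2 = 0" and n: "n > 0"
  shows "\<exists>d::int. (\<Prod>j\<in>{1..(n - 1) div 2}. ev p (zeta n j)) =
    of_int (int (if odd n then n else n div 2) * d)"
proof -
  have "[:- 2, 1:] dvd p" using p by (simp add: poly_eq_0_iff_dvd)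
  then obtain q where "p = [:- 2, 1:] * q" by (elim dvdE)
  then have p_ev: "ev p z = (2 - (z + inverse z)) * ev (- q) z" for z
    by (simp only: ev_arith) (simp add: algebra_simps)
  obtain d :: int where d: "(\<Prod>j\<in>{1..(n - 1) div 2}. ev (- q) (zeta n j)) = of_int d"
    using prod_half_period(1)[OF n] by blast
  show ?thesis
    unfolding p_ev prod.distrib d prod_half_period(2)[OF n] by (intro exI[of _ d]) simp
qed

text \<open>Values of an integer polynomial at 2 and -2 are congruent modulo 4.\<close>

lemma poly_minus_2_mod_4:
  fixes p :: "int poly"
  assumes "poly p 2 = 0"
  obtains x where "poly p (- 2) = 4 * x"
proof -
  have "[:- 2, 1:] dvd p" using assms by (simp add: poly_eq_0_iff_dvd)
  then obtain q where "p = [:- 2, 1:] * q" by (elim dvdE)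
  then have "poly p (- 2) = 4 * - poly q (- 2)" by simp
  then show ?thesis by (rule that)
qed

lemma zeta_half: "m > 0 \<Longrightarrow> zeta (2 * m) m = - 1"
  by (simp add: zeta_def)

text \<open>For odd \<open>n\<close> the squared half product supplies n^2. For even
  \<open>n\<close> it supplies only (n/2)^2, and the missing 4 comes from the middle factor
  \<open>poly p (- 2) = 4 * x\<close>.\<close>

lemma square_form_uniform:
  fixes t s :: int
  assumes n: "n > 0" and p: "poly p 2 = 0"
    and t: "of_int (int n * t) = of_int s * (\<Prod>j = 1..<n. ev p (zeta n j))"
  shows "odd n \<Longrightarrow> \<exists>a. t = int n * s * a\<^sup>2"
    and "even n \<Longrightarrow> \<exists>b. t = int n * s * squarefree_part (poly p (- 2)) * b\<^sup>2"
proof -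
  obtain d where d: "(\<Prod>j\<in>{1..(n - 1) div 2}. ev p (zeta n j)) =
      of_int (int (if odd n then n else n div 2) * d)"
    using prod_half_period_double_root[OF p n] by blast
  have prod: "(\<Prod>j = 1..<n. ev p (zeta n j)) = (if odd n then 1 else ev p (zeta n (n div 2))) *
      (of_int (int (if odd n then n else n div 2) * d))\<^sup>2"
    unfolding d[symmetric] using n
    by (intro prod_symmetric) (auto simp: zeta_reflect ev_inverse)
  show "\<exists>a. t = int n * s * a\<^sup>2" if "odd n"
  proof -
    have "of_int (int n * t) = (of_int (s * (int n * d)\<^sup>2) :: complex)"
      using t that unfolding prod by simp
    then have "int n * t = s * (int n * d)\<^sup>2" by (simp only: of_int_eq_iff)
    also have "\<dots> = int n * (int n * s * d\<^sup>2)" by (simp add: power2_eq_square)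
    finally show ?thesis using n by auto
  qed
  show "\<exists>b. t = int n * s * squarefree_part (poly p (- 2)) * b\<^sup>2" if "even n"
  proof -
    define m where "m = n div 2"
    have nm: "n = 2 * m" "m > 0" using that n unfolding m_def by auto
    obtain x where x: "poly p (- 2) = 4 * x" by (rule poly_minus_2_mod_4[OF p])
    obtain r where r: "x = squarefree_part (4 * x) * r\<^sup>2" by (rule square_class_quarter)
    have "of_int (int n * t) = (of_int (s * (poly p (- 2) * (int m * d)\<^sup>2)) :: complex)"
      using t that nm unfolding prod by (simp add: zeta_half ev_minus_1)
    then have "int n * t = s * (4 * x * (int m * d)\<^sup>2)" unfolding x by (simp only: of_int_eq_iff)
    also have "\<dots> = int n * (int n * s * x * d\<^sup>2)" by (simp add: power2_eq_square nm)
    finally have "t = int n * s * x * d\<^sup>2" using n by simp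
    also have "\<dots> = int n * s * squarefree_part (poly p (- 2)) * (r * d)\<^sup>2"
      unfolding x by (subst r) (simp add: power_mult_distrib)
    finally show ?thesis ..
  qed
qed

text \<open>With \<open>m = n div 2\<close>, the even indices form the half period of the m-th roots
  of unity. For odd \<open>m\<close> the square contains m^2 and the middle factor is
  \<open>poly p' (- 2)\<close>. For even \<open>m\<close> it contains only (m/2)^2, but the middle
  factor is \<open>poly p (- 2)\<close>, which supplies a 4.\<close>

lemma square_form_alternating:
  fixes t s :: int
  assumes n: "n > 0" "even n" and p: "poly p 2 = 0"
    and t: "of_int (int n * t) = of_int s * (\<Prod>j = 1..<n. ev (if even j then p else p') (zeta n j))"
  shows "odd (n div 2) \<Longrightarrow> \<exists>a. 4 * t = int n * s * squarefree_part (poly p' (- 2)) * a\<^sup>2"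
    and "even (n div 2) \<Longrightarrow> \<exists>b. 4 * t = int n * s * squarefree_part (poly p (- 2)) * b\<^sup>2"
proof -
  let ?F = "\<lambda>j. ev (if even j then p else p') (zeta n j)"
  define m where "m = n div 2"
  have nm: "n = 2 * m" and m: "m > 0" using n unfolding m_def by auto
  obtain d where d: "(\<Prod>j\<in>{1..(m - 1) div 2}. ev p (zeta m j)) =
      of_int (int (if odd m then m else m div 2) * d)"
    using prod_half_period_double_root[OF p m] by blast
  obtain e where e: "(\<Prod>j\<in>{j. j < m \<and> odd j}. ev p' (zeta (2 * m) j)) = of_int e"
    using prod_odd_half_period[OF m] by blast
  let ?E = "(\<lambda>i. 2 * i) ` {1..(m - 1) div 2}"
  have zeta_even: "zeta n (2 * i) = zeta m i" for i by (simp add: nm zeta_def algebra_simps)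
  have "{1..(n - 1) div 2} = ?E \<union> {j. j < m \<and> odd j}"
  proof (intro equalityI subsetI)
    fix j assume j: "j \<in> {1..(n - 1) div 2}"
    then have "j < m" unfolding nm by auto
    show "j \<in> ?E \<union> {j. j < m \<and> odd j}"
    proof (cases "even j")
      case True
      then obtain i where "j = 2 * i" by (elim evenE)
      then show ?thesis using \<open>j < m\<close> j by auto
    qed (use \<open>j < m\<close> in auto)
  qed (auto simp: nm elim!: oddE)
  then have "(\<Prod>j\<in>{1..(n - 1) div 2}. ?F j) = (\<Prod>j\<in>?E. ?F j) * (\<Prod>j\<in>{j. j < m \<and> odd j}. ?F j)"
    by (simp only:, intro prod.union_disjoint) auto
  also have "(\<Prod>j\<in>?E. ?F j) = (\<Prod>j\<in>{1..(m - 1) div 2}. ev p (zeta m j))"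
    by (subst prod.reindex) (auto simp: inj_on_def zeta_even)
  also have "(\<Prod>j\<in>{j. j < m \<and> odd j}. ?F j) = of_int e"
    unfolding e[symmetric] nm by (intro prod.cong) auto
  finally have half: "(\<Prod>j\<in>{1..(n - 1) div 2}. ?F j) =
      of_int (int (if odd m then m else m div 2) * d * e)" unfolding d by simp
  have prod: "(\<Prod>j = 1..<n. ?F j) = (if odd n then 1 else ?F (n div 2)) *
      (of_int (int (if odd m then m else m div 2) * d * e))\<^sup>2"
    unfolding half[symmetric] using n
    by (intro prod_symmetric) (auto simp: zeta_reflect ev_inverse)
  have mid: "?F (n div 2) = of_int (poly (if even m then p else p') (- 2))"
    using m by (simp add: nm zeta_half ev_minus_1)
  show "\<exists>a. 4 * t = int n * s * squarefree_part (poly p' (- 2)) * a\<^sup>2" if odd: "odd (n div 2)"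
  proof -
    let ?q = "squarefree_part (poly p' (- 2))" and ?r = "square_part (poly p' (- 2))"
    have "odd m" using odd unfolding m_def .
    then have "of_int (int n * t) = (of_int (s * (poly p' (- 2) * (int m * d * e)\<^sup>2)) :: complex)"
      using t n unfolding prod mid by simp
    then have "int n * t = s * (poly p' (- 2) * (int m * d * e)\<^sup>2)" by (simp only: of_int_eq_iff)
    also have "\<dots> = s * (?q * ?r\<^sup>2 * (int m * d * e)\<^sup>2)" by (simp flip: squarefree_decompose)
    finally have "int n * (4 * t) = int n * (int n * s * ?q * (?r * d * e)\<^sup>2)"
      by (simp add: nm power_mult_distrib power2_eq_square ac_simps)
    then show ?thesis using n by auto
  qed
  show "\<exists>b. 4 * t = int n * s * squarefree_part (poly p (- 2)) * b\<^sup>2" if even: "even (n div 2)"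
  proof -
    obtain l where l: "m = 2 * l" using even unfolding m_def by (elim evenE)
    obtain x where x: "poly p (- 2) = 4 * x" by (rule poly_minus_2_mod_4[OF p])
    obtain r where r: "x = squarefree_part (4 * x) * r\<^sup>2" by (rule square_class_quarter)
    have "of_int (int n * t) = (of_int (s * (poly p (- 2) * (int l * d * e)\<^sup>2)) :: complex)"
      using t n l unfolding prod mid by simp
    then have "int n * t = s * (4 * x * (int l * d * e)\<^sup>2)" unfolding x by (simp only: of_int_eq_iff)
    then have "int n * (4 * t) = int n * (int n * s * x * (d * e)\<^sup>2)"
      by (simp add: nm l power_mult_distrib power2_eq_square ac_simps)
    then have "4 * t = int n * s * x * (d * e)\<^sup>2" using n by auto
    also have "\<dots> = int n * s * squarefree_part (poly p (- 2)) * (r * d * e)\<^sup>2"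
      unfolding x by (subst r) (simp add: power_mult_distrib)
    finally show ?thesis ..
  qed
qed

section \<open>The symbols as integer polynomials in z + 1/z\<close>

lemma power_sums_ev:
  assumes "finite A"
  shows "\<exists>p. \<forall>z. z \<noteq> 0 \<longrightarrow> ev p z = (\<Sum>a\<in>A. z powi int a + z powi (- int a))"
  using assms
proof (induction A rule: finite_induct)
  case (insert a A)
  then obtain p where "\<forall>z. z \<noteq> 0 \<longrightarrow> ev p z = (\<Sum>a\<in>A. z powi int a + z powi (- int a))" by blast
  moreover obtain q where "\<forall>z. z \<noteq> 0 \<longrightarrow> ev q z = z powi int a + z powi (- int a)"
    using power_sum_ev by blast
  ultimately show ?case using insert.hyps by (intro exI[of _ "q + p"]) auto
qed (auto intro: exI[of _ 0])

text \<open>Cross terms come in pairs z^(c-b) and z^(b-c), so the product is symmetric although each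
  factor is not.\<close>

lemma autocorrelation_ev:
  assumes "finite C"
  shows "\<exists>p. \<forall>z. z \<noteq> 0 \<longrightarrow> ev p z = (\<Sum>c\<in>C. z powi int c) * (\<Sum>c\<in>C. z powi (- int c))"
  using assms
proof (induction C rule: finite_induct)
  case (insert c C)
  then obtain p where p: "\<And>z. z \<noteq> 0 \<Longrightarrow>
      ev p z = (\<Sum>c\<in>C. z powi int c) * (\<Sum>c\<in>C. z powi (- int c))" by blast
  have "\<exists>q. \<forall>z. z \<noteq> 0 \<longrightarrow> ev q z = (\<Sum>b\<in>C. z powi (int c - int b) + z powi (- (int c - int b)))"
    using insert.hyps(1)
  proof (induction C rule: finite_induct)
    case (insert b C)
    then obtain q where "\<forall>z. z \<noteq> 0 \<longrightarrow>
        ev q z = (\<Sum>b\<in>C. z powi (int c - int b) + z powi (- (int c - int b)))" by blast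
    moreover obtain q' where "\<forall>z. z \<noteq> 0 \<longrightarrow>
        ev q' z = z powi (int c - int b) + z powi (- (int c - int b))"
      using power_sum_ev by blast
    ultimately show ?case using insert.hyps by (intro exI[of _ "q' + q"]) auto
  qed (auto intro: exI[of _ 0])
  then obtain q where q: "\<And>z. z \<noteq> 0 \<Longrightarrow>
      ev q z = (\<Sum>b\<in>C. z powi (int c - int b) + z powi (- (int c - int b)))" by blast
  \<comment> \<open>1 is the product of the new term with its own inverse, \<open>q\<close> collects
    the cross terms with \<open>C\<close>, and \<open>p\<close> is the old product.\<close>
  have "ev (1 + q + p) z =
      (\<Sum>c\<in>insert c C. z powi int c) * (\<Sum>c\<in>insert c C. z powi (- int c))" if z: "z \<noteq> 0" for z
  proof -
    have "z powi (int c - int b) + z powi (- (int c - int b)) =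
        z powi int c * z powi (- int b) + z powi (- int c) * z powi int b" for b
    proof -
      have "int c - int b = int c + - int b" "- (int c - int b) = - int c + int b" by simp_all
      then show ?thesis using z by (simp only: power_int_add simp_thms)
    qed
    then have "ev q z = z powi int c * (\<Sum>b\<in>C. z powi (- int b)) +
        z powi (- int c) * (\<Sum>b\<in>C. z powi int b)"
      unfolding q[OF z] by (simp add: sum.distrib sum_distrib_left)
    moreover have "z powi int c * z powi (- int c) = 1"
      using z by (simp add: power_int_minus)
    ultimately show ?thesis
      using insert.hyps by (simp add: p[OF z] algebra_simps)
  qed
  then show ?case by blast
qed (auto intro: exI[of _ 0])

lemma sum_minus_one_power:
  assumes "finite A"
  shows "(\<Sum>a\<in>A. (- 1) ^ a) = (of_nat (card {a\<in>A. even a}) - of_nat (card {a\<in>A. odd a}) :: 'a :: ring_1)"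
proof -
  have "(\<Sum>a\<in>A. (- 1) ^ a :: 'a) = (\<Sum>a\<in>A. if even a then 1 else - 1)"
    by (intro sum.cong) auto
  also have "\<dots> = (\<Sum>a\<in>A \<inter> {a. even a}. 1) + (\<Sum>a\<in>A \<inter> - {a. even a}. - 1)"
    using assms by (rule sum.If_cases)
  also have "A \<inter> {a. even a} = {a\<in>A. even a}" by auto
  also have "A \<inter> - {a. even a} = {a\<in>A. odd a}" by auto
  finally show ?thesis by simp
qed

lemma card_even_odd:
  assumes "finite A"
  shows "card A = card {a\<in>A. even a} + card {a\<in>A. odd a}"
proof -
  have "A = {a\<in>A. even a} \<union> {a\<in>A. odd a}" by auto
  then have "card A = card ({a\<in>A. even a} \<union> {a\<in>A. odd a})" by simp
  also have "\<dots> = card {a\<in>A. even a} + card {a\<in>A. odd a}"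
    using assms by (intro card_Un_disjoint) auto
  finally show ?thesis .
qed

text \<open>At z = -1 each parameter contributes 2 - 2(-1)^a, which is 4 for odd a and 0 for even a;
  at z = 1 all contributions vanish.\<close>

lemma lap_poly:
  assumes "distinct \<alpha>"
  obtains p where
    "\<And>z. z \<noteq> 0 \<Longrightarrow> ev p z = of_nat (2 * length \<alpha> + s) - (\<Sum>a\<in>set \<alpha>. z powi int a + z powi (- int a))"
    "poly p 2 = int s" "poly p (- 2) = 4 * odd_count \<alpha> + int s"
proof -
  obtain q where "\<And>z. z \<noteq> 0 \<Longrightarrow> ev q z = (\<Sum>a\<in>set \<alpha>. z powi int a + z powi (- int a))"
    using power_sums_ev[of "set \<alpha>"] by auto
  then have p: "ev (of_nat (2 * length \<alpha> + s) - q) z =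
      of_nat (2 * length \<alpha> + s) - (\<Sum>a\<in>set \<alpha>. z powi int a + z powi (- int a))" if "z \<noteq> 0" for z
    using that by (simp del: of_nat_add of_nat_mult)
  let ?p = "of_nat (2 * length \<alpha> + s) - q"
  have len: "length \<alpha> = card (set \<alpha>)" using assms by (simp add: distinct_card)
  have "of_int (poly ?p 2) = (of_int (int s) :: complex)"
    unfolding ev_1[symmetric] by (subst p) (simp_all add: len)
  then have 2: "poly ?p 2 = int s" by (simp only: of_int_eq_iff)
  have "of_int (poly ?p (- 2)) = of_nat (2 * length \<alpha> + s) - 2 * (\<Sum>a\<in>set \<alpha>. (- 1) ^ a :: complex)"
    unfolding ev_minus_1[symmetric] by (subst p) (simp_all add: sum_distrib_left power_int_minus flip: power_inverse)
  also have "\<dots> = of_int (4 * odd_count \<alpha> + int s)"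
    unfolding sum_minus_one_power[OF finite_set] len card_even_odd[OF finite_set[of \<alpha>]] odd_count_def by simp
  finally have "poly ?p (- 2) = 4 * odd_count \<alpha> + int s" by (simp only: of_int_eq_iff)
  with p 2 show ?thesis by (rule that)
qed

lemma autocorrelation_poly:
  assumes "distinct \<gamma>"
  obtains p where
    "\<And>z. z \<noteq> 0 \<Longrightarrow> ev p z = (\<Sum>c\<in>set \<gamma>. z powi int c) * (\<Sum>c\<in>set \<gamma>. z powi (- int c))"
    "poly p 2 = int (length \<gamma>) ^ 2" "poly p (- 2) = (even_count \<gamma> - odd_count \<gamma>)\<^sup>2"
proof -
  obtain p where p: "\<And>z. z \<noteq> 0 \<Longrightarrow>
      ev p z = (\<Sum>c\<in>set \<gamma>. z powi int c) * (\<Sum>c\<in>set \<gamma>. z powi (- int c))"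
    using autocorrelation_ev[of "set \<gamma>"] by auto
  have "of_int (poly p 2) = (of_int (int (length \<gamma>) ^ 2) :: complex)"
    unfolding ev_1[symmetric] by (subst p) (simp_all add: distinct_card[OF assms] power2_eq_square)
  then have 2: "poly p 2 = int (length \<gamma>) ^ 2" by (simp only: of_int_eq_iff)
  have "of_int (poly p (- 2)) = (\<Sum>c\<in>set \<gamma>. (- 1) ^ c :: complex)\<^sup>2"
    unfolding ev_minus_1[symmetric]
    by (subst p) (simp_all add: power2_eq_square power_int_minus flip: power_inverse)
  also have "\<dots> = of_int ((even_count \<gamma> - odd_count \<gamma>)\<^sup>2)"
    unfolding sum_minus_one_power[OF finite_set] even_count_def odd_count_def by simp
  finally have "poly p (- 2) = (even_count \<gamma> - odd_count \<gamma>)\<^sup>2" by (simp only: of_int_eq_iff)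
  with p 2 show ?thesis by (rule that)
qed

section \<open>Connection sets modulo n\<close>

text \<open>The residues a lie below n/2 and the residues n - a above it, so no two of them
  collide.\<close>

lemma sum_pm_residues:
  fixes f :: "int \<Rightarrow> 'a :: comm_monoid_add"
  assumes "\<forall>a\<in>set \<alpha>. 1 \<le> a" "\<forall>a\<in>set \<alpha>. 2 * a < n"
  shows "(\<Sum>k\<in>pm_residues n \<alpha>. f k) = (\<Sum>a\<in>set \<alpha>. f (int a mod int n) + f ((- int a) mod int n))"
proof -
  have "(\<Sum>k\<in>pm_residues n \<alpha>. f k) = (\<Sum>a\<in>set \<alpha>. \<Sum>k\<in>{int a mod int n, (- int a) mod int n}. f k)"
    unfolding pm_residues_def
  proof (rule sum.UNION_disjoint)
    show "\<forall>a\<in>set \<alpha>. \<forall>b\<in>set \<alpha>. a \<noteq> b \<longrightarrow>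
        {int a mod int n, (- int a) mod int n} \<inter> {int b mod int n, (- int b) mod int n} = {}"
    proof (intro ballI impI)
      fix a b assume ab: "a \<in> set \<alpha>" "b \<in> set \<alpha>" "a \<noteq> b"
      then have lt: "1 \<le> a" "2 * a < n" "1 \<le> b" "2 * b < n" using assms by auto
      then have "int a mod int n = int a" "int b mod int n = int b"
        "(- int a) mod int n = int n - int a" "(- int b) mod int n = int n - int b"
        by (auto simp: zmod_zminus1_eq_if)
      then show "{int a mod int n, (- int a) mod int n} \<inter> {int b mod int n, (- int b) mod int n} = {}"
        using lt ab(3) by auto
    qed
  qed auto
  also have "\<dots> = (\<Sum>a\<in>set \<alpha>. f (int a mod int n) + f ((- int a) mod int n))"
  proof (rule sum.cong[OF refl])
    fix a assume "a \<in> set \<alpha>"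
    then have "1 \<le> a" "2 * a < n" using assms by auto
    then have "int a mod int n \<noteq> (- int a) mod int n" by (auto simp: zmod_zminus1_eq_if)
    then show "(\<Sum>k\<in>{int a mod int n, (- int a) mod int n}. f k) =
        f (int a mod int n) + f ((- int a) mod int n)" by simp
  qed
  finally show ?thesis .
qed

text \<open>The optional element n/2; two such flags let one statement cover all four
  graphs.\<close>

definition half :: "nat \<Rightarrow> bool \<Rightarrow> int set" where
  "half n x = (if x then {int n div 2} else {})"

lemma sum_pm_residues_half:
  fixes f :: "int \<Rightarrow> 'a :: comm_monoid_add"
  assumes \<alpha>: "\<forall>a\<in>set \<alpha>. 1 \<le> a" "\<forall>a\<in>set \<alpha>. 2 * a < n" and x: "x \<longrightarrow> even n"
  shows "(\<Sum>k\<in>pm_residues n \<alpha> \<union> half n x. f k) =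
    (\<Sum>a\<in>set \<alpha>. f (int a mod int n) + f ((- int a) mod int n)) + (if x then f (int n div 2) else 0)"
proof -
  have "int n div 2 \<notin> pm_residues n \<alpha>" if x
  proof
    assume "int n div 2 \<in> pm_residues n \<alpha>"
    then obtain a where a: "a \<in> set \<alpha>"
      "int n div 2 = int a mod int n \<or> int n div 2 = (- int a) mod int n"
      unfolding pm_residues_def by auto
    then have "1 \<le> a" "2 * a < n" using \<alpha> by auto
    then show False using a(2) x that by (auto simp: zmod_zminus1_eq_if elim!: evenE)
  qed
  moreover have "finite (pm_residues n \<alpha>)" unfolding pm_residues_def by auto
  ultimately have "(\<Sum>k\<in>pm_residues n \<alpha> \<union> half n x. f k) =
      (\<Sum>k\<in>pm_residues n \<alpha>. f k) + (\<Sum>k\<in>half n x. f k)"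
    unfolding half_def by (intro sum.union_disjoint) auto
  then show ?thesis unfolding sum_pm_residues[OF \<alpha>] half_def by simp
qed

lemma pm_residues_half:
  assumes "n > 0" and \<alpha>: "\<forall>a\<in>set \<alpha>. 1 \<le> a" "\<forall>a\<in>set \<alpha>. 2 * a < n" and x: "x \<longrightarrow> even n"
  shows "pm_residues n \<alpha> \<union> half n x \<subseteq> {0<..<int n}"
    and "k \<in> pm_residues n \<alpha> \<union> half n x \<Longrightarrow> (- k) mod int n \<in> pm_residues n \<alpha> \<union> half n x"
proof -
  have "0 < int a mod int n \<and> int a mod int n < int n \<and> 0 < (- int a) mod int n \<and> (- int a) mod int n < int n"
    if "a \<in> set \<alpha>" for a
  proof -
    have "1 \<le> a" "2 * a < n" using that \<alpha> by auto
    then show ?thesis by (auto simp: zmod_zminus1_eq_if)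
  qed
  moreover have "0 < int n div 2 \<and> int n div 2 < int n" if x
    using x that assms(1) by (auto elim!: evenE)
  ultimately show "pm_residues n \<alpha> \<union> half n x \<subseteq> {0<..<int n}"
    unfolding pm_residues_def half_def by auto
  have "(- (int n div 2)) mod int n = int n div 2" if x
    using x that assms(1) by (auto simp: zmod_zminus1_eq_if elim!: evenE)
  then show "(- k) mod int n \<in> pm_residues n \<alpha> \<union> half n x" if "k \<in> pm_residues n \<alpha> \<union> half n x"
    using that unfolding pm_residues_def half_def by (auto simp: mod_minus_eq split: if_splits)
qed

lemma sum_residues_of:
  assumes "\<forall>c\<in>set \<gamma>. c < n"
  shows "(\<Sum>k\<in>residues_of n \<gamma>. f k) = (\<Sum>c\<in>set \<gamma>. f (int c mod int n))"
proof -
  have "inj_on (\<lambda>c. int c mod int n) (set \<gamma>)" using assms by (auto simp: inj_on_def)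
  then show ?thesis unfolding residues_of_def by (simp add: sum.reindex)
qed

text \<open>Adding n/2 to a connection set raises the degree by 1 and subtracts this power. The net
  change 1 - (-1)^j is 0 for even \<open>j\<close> and 2 for odd \<open>j\<close>, the origin of the
  shifts by 2 in P_2, P_3 and P_4.\<close>

lemma zeta_half_period:
  assumes "n > 0" "even n"
  shows "zeta n j powi (int n div 2) = (- 1) ^ j"
proof -
  obtain m where m: "n = 2 * m" using assms(2) by (elim evenE)
  have "zeta n j powi (int n div 2) = zeta n (j * m)" by (simp add: m zeta_power)
  also have "\<dots> = zeta n m ^ j" by (simp add: zeta_power mult.commute)
  finally show ?thesis using assms(1) by (simp add: m zeta_half)
qed

text \<open>At n-th roots of unity exponents matter only modulo \<open>n\<close>, so the residue
  sums are values of \<open>pa\<close>, \<open>pb\<close> and \<open>pc\<close>, polynomials that do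
  not depend on \<open>n\<close>. This lets fixed square-free parts serve every
  \<open>n\<close>.\<close>

lemma spanning_tree_count_symbol:
  fixes \<alpha> \<beta> \<gamma> :: "nat list"
  defines "s \<equiv> length \<gamma>"
  assumes n: "n > 0"
    and \<alpha>: "distinct \<alpha>" "\<forall>a\<in>set \<alpha>. 1 \<le> a" "\<forall>a\<in>set \<alpha>. 2 * a < n"
    and \<beta>: "distinct \<beta>" "\<forall>b\<in>set \<beta>. 1 \<le> b" "\<forall>b\<in>set \<beta>. 2 * b < n"
    and \<gamma>: "distinct \<gamma>" "\<forall>c\<in>set \<gamma>. c < n"
    and xy: "x \<or> y \<longrightarrow> even n"
    and pa: "\<And>z. z \<noteq> 0 \<Longrightarrow> ev pa z = of_nat (2 * length \<alpha> + s) - (\<Sum>a\<in>set \<alpha>. z powi int a + z powi (- int a))"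
    and pb: "\<And>z. z \<noteq> 0 \<Longrightarrow> ev pb z = of_nat (2 * length \<beta> + s) - (\<Sum>a\<in>set \<beta>. z powi int a + z powi (- int a))"
    and pc: "\<And>z. z \<noteq> 0 \<Longrightarrow> ev pc z = (\<Sum>c\<in>set \<gamma>. z powi int c) * (\<Sum>c\<in>set \<gamma>. z powi (- int c))"
  shows "of_int (int n * int (\<tau> (BC n (pm_residues n \<alpha> \<union> half n x) (pm_residues n \<beta> \<union> half n y)
      (residues_of n \<gamma>)))) = of_int (int s) * (\<Prod>j = 1..<n. ev (if even j then pa * pb - pc
        else (pa + (if x then 2 else 0)) * (pb + (if y then 2 else 0)) - pc) (zeta n j))"
proof -
  let ?R = "pm_residues n \<alpha> \<union> half n x" and ?T = "pm_residues n \<beta> \<union> half n y" and ?S = "residues_of n \<gamma>"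
  have x: "x \<longrightarrow> even n" and y: "y \<longrightarrow> even n" using xy by auto
  interpret bicirculant n ?R ?T ?S
  proof
    show "?S \<subseteq> {0..<int n}" using n unfolding residues_of_def by auto
  qed (use n pm_residues_half[OF n \<alpha>(2,3) x] pm_residues_half[OF n \<beta>(2,3) y] in blast)+
  have cS: "card ?S = s"
    using sum_residues_of[OF \<gamma>(2), of "\<lambda>_. 1 :: nat"] \<gamma>(1) by (simp add: s_def distinct_card)
  have cR: "card ?R = 2 * length \<alpha> + (if x then 1 else 0)"
    using sum_pm_residues_half[OF \<alpha>(2,3) x, where f = "\<lambda>_. 1 :: nat"] \<alpha>(1) by (simp add: distinct_card)
  have cT: "card ?T = 2 * length \<beta> + (if y then 1 else 0)"
    using sum_pm_residues_half[OF \<beta>(2,3) y, where f = "\<lambda>_. 1 :: nat"] \<beta>(1) by (simp add: distinct_card)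
  have "symbol_det j = ev (if even j then pa * pb - pc
        else (pa + (if x then 2 else 0)) * (pb + (if y then 2 else 0)) - pc) (zeta n j)" for j
  proof -
    let ?z = "zeta n j"
    have [simp]: "?z powi (k mod int n) = ?z powi k" for k
      by (rule power_int_mod) (simp_all add: zeta_power_n n)
    have minus: "?z powi (- (k mod int n)) = ?z powi (- k)" for k
      by (simp add: power_int_minus)
    have half: "?z powi (int n div 2) = (if even j then 1 else - 1)" if "even n"
      using zeta_half_period[OF n that] by simp
    have R: "of_nat (card ?R + card ?S) - (\<Sum>k\<in>?R. ?z powi k) =
        ev pa ?z + (if x \<and> odd j then 2 else 0)"
      unfolding sum_pm_residues_half[OF \<alpha>(2,3) x] cR cS pa[OF zeta_nonzero]
      using half x by (simp add: algebra_simps)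
    have T: "of_nat (card ?T + card ?S) - (\<Sum>k\<in>?T. ?z powi k) =
        ev pb ?z + (if y \<and> odd j then 2 else 0)"
      unfolding sum_pm_residues_half[OF \<beta>(2,3) y] cT cS pb[OF zeta_nonzero]
      using half y by (simp add: algebra_simps)
    have S: "(\<Sum>k\<in>?S. ?z powi k) * (\<Sum>k\<in>?S. ?z powi (- k)) = ev pc ?z"
      unfolding sum_residues_of[OF \<gamma>(2)] minus pc[OF zeta_nonzero] by simp
    show ?thesis unfolding symbol_det_def R T S by simp
  qed
  then show ?thesis using spanning_tree_count_BC unfolding cS by simp
qed

lemma sorted_strict_distinct: "sorted_wrt (<) (xs :: nat list) \<Longrightarrow> distinct xs"
  by (simp add: strict_sorted_iff)

theorem theorem4p1:
  fixes \<alpha> \<beta> \<gamma> :: "nat list"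
    and s k1 k2 m1 m2 h1 h2 q1 q2 q3 q4 :: int
  assumes "sorted_wrt (<) \<alpha>" and "\<forall>a\<in>set \<alpha>. 1 \<le> a"
    and "sorted_wrt (<) \<beta>" and "\<forall>b\<in>set \<beta>. 1 \<le> b"
    and "sorted_wrt (<) \<gamma>" and "1 \<le> length \<gamma>"
    and "P\<^sub>1 \<alpha> \<beta> \<gamma> \<noteq> 0" and "P\<^sub>2 \<alpha> \<beta> \<gamma> \<noteq> 0" and "P\<^sub>3 \<alpha> \<beta> \<gamma> \<noteq> 0" and "P\<^sub>4 \<alpha> \<beta> \<gamma> \<noteq> 0"
    and "laurent_degree (P\<^sub>2 \<alpha> \<beta> \<gamma>) = laurent_degree (P\<^sub>1 \<alpha> \<beta> \<gamma>)"
    and "laurent_degree (P\<^sub>3 \<alpha> \<beta> \<gamma>) = laurent_degree (P\<^sub>1 \<alpha> \<beta> \<gamma>)"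
    and "laurent_degree (P\<^sub>4 \<alpha> \<beta> \<gamma>) = laurent_degree (P\<^sub>1 \<alpha> \<beta> \<gamma>)"
    and "s = int (length \<gamma>)"
    and "k1 = odd_count \<alpha>" and "k2 = even_count \<alpha>"
    and "m1 = odd_count \<beta>" and "m2 = even_count \<beta>"
    and "h1 = odd_count \<gamma>" and "h2 = even_count \<gamma>"
    and "q1 = squarefree_part ((4 * k1 + s) * (4 * m1 + s) - (h2 - h1)^2)"
    and "q2 = squarefree_part ((4 * k1 + s + 2) * (4 * m1 + s) - (h2 - h1)^2)"
    and "q3 = squarefree_part ((4 * k1 + s) * (4 * m1 + s + 2) - (h2 - h1)^2)"
    and "q4 = squarefree_part ((4 * k1 + s + 2) * (4 * m1 + s + 2) - (h2 - h1)^2)"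
  shows
    "(\<exists>(a1 :: nat \<Rightarrow> int) (b1 :: nat \<Rightarrow> int). \<forall>n :: nat. admissible \<alpha> \<beta> \<gamma> n \<longrightarrow>
        (odd n \<longrightarrow> real (\<tau> (\<Gamma>\<^sub>1 \<alpha> \<beta> \<gamma> n)) =
            real n * real_of_int s * (real_of_int (a1 n))^2) \<and>
        (even n \<longrightarrow> real (\<tau> (\<Gamma>\<^sub>1 \<alpha> \<beta> \<gamma> n)) =
            real n * real_of_int s * real_of_int q1 * (real_of_int (b1 n))^2)) \<and>
     (\<exists>(a2 :: nat \<Rightarrow> int) (b2 :: nat \<Rightarrow> int). \<forall>n :: nat. admissible \<alpha> \<beta> \<gamma> n \<and> even n \<longrightarrow>
        (odd (n div 2) \<longrightarrow> real (\<tau> (\<Gamma>\<^sub>2 \<alpha> \<beta> \<gamma> n)) =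
            1 / 4 * real n * real_of_int s * real_of_int q2 * (real_of_int (a2 n))^2) \<and>
        (even (n div 2) \<longrightarrow> real (\<tau> (\<Gamma>\<^sub>2 \<alpha> \<beta> \<gamma> n)) =
            1 / 4 * real n * real_of_int s * real_of_int q1 * (real_of_int (b2 n))^2)) \<and>
     (\<exists>(a3 :: nat \<Rightarrow> int) (b3 :: nat \<Rightarrow> int). \<forall>n :: nat. admissible \<alpha> \<beta> \<gamma> n \<and> even n \<longrightarrow>
        (odd (n div 2) \<longrightarrow> real (\<tau> (\<Gamma>\<^sub>3 \<alpha> \<beta> \<gamma> n)) =
            1 / 4 * real n * real_of_int s * real_of_int q3 * (real_of_int (a3 n))^2) \<and>
        (even (n div 2) \<longrightarrow> real (\<tau> (\<Gamma>\<^sub>3 \<alpha> \<beta> \<gamma> n)) =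
            1 / 4 * real n * real_of_int s * real_of_int q1 * (real_of_int (b3 n))^2)) \<and>
     (\<exists>(a4 :: nat \<Rightarrow> int) (b4 :: nat \<Rightarrow> int). \<forall>n :: nat. admissible \<alpha> \<beta> \<gamma> n \<and> even n \<longrightarrow>
        (odd (n div 2) \<longrightarrow> real (\<tau> (\<Gamma>\<^sub>4 \<alpha> \<beta> \<gamma> n)) =
            1 / 4 * real n * real_of_int s * real_of_int q4 * (real_of_int (a4 n))^2) \<and>
        (even (n div 2) \<longrightarrow> real (\<tau> (\<Gamma>\<^sub>4 \<alpha> \<beta> \<gamma> n)) =
            1 / 4 * real n * real_of_int s * real_of_int q1 * (real_of_int (b4 n))^2))"
proof -
  note \<alpha> = sorted_strict_distinct[OF assms(1)] and \<beta> = sorted_strict_distinct[OF assms(3)]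
    and \<gamma> = sorted_strict_distinct[OF assms(5)]
  let ?s = "length \<gamma>"
  obtain pa where pa: "\<And>z. z \<noteq> 0 \<Longrightarrow> ev pa z =
      of_nat (2 * length \<alpha> + ?s) - (\<Sum>a\<in>set \<alpha>. z powi int a + z powi (- int a))"
    "poly pa 2 = s" "poly pa (- 2) = 4 * k1 + s" using lap_poly[OF \<alpha>, of ?s] assms(14,15) by metis
  obtain pb where pb: "\<And>z. z \<noteq> 0 \<Longrightarrow> ev pb z =
      of_nat (2 * length \<beta> + ?s) - (\<Sum>a\<in>set \<beta>. z powi int a + z powi (- int a))"
    "poly pb 2 = s" "poly pb (- 2) = 4 * m1 + s" using lap_poly[OF \<beta>, of ?s] assms(14,17) by metis
  obtain pc where pc: "\<And>z. z \<noteq> 0 \<Longrightarrow> ev pc z =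
      (\<Sum>c\<in>set \<gamma>. z powi int c) * (\<Sum>c\<in>set \<gamma>. z powi (- int c))"
    "poly pc 2 = s\<^sup>2" "poly pc (- 2) = (h2 - h1)\<^sup>2"
    using autocorrelation_poly[OF \<gamma>] assms(14,19,20) by metis
  define p where "p = pa * pb - pc"
  define p' where "p' x y = (pa + (if x then 2 else 0)) * (pb + (if y then 2 else 0)) - pc" for x y
  \<comment> \<open>Both Laplacian factors equal s at z = 1, and the autocorrelation equals
    s^2.\<close>
  have p2: "poly p 2 = 0" by (simp add: p_def pa pb pc power2_eq_square)
  have q1: "q1 = squarefree_part (poly p (- 2))" by (simp add: p_def pa pb pc assms(21))
  have q: "q2 = squarefree_part (poly (p' True False) (- 2))"
    "q3 = squarefree_part (poly (p' False True) (- 2))"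
    "q4 = squarefree_part (poly (p' True True) (- 2))"
    by (simp_all add: p'_def pa pb pc assms(22-24) ac_simps)
  let ?\<tau> = "\<lambda>x y n. \<tau> (BC n (pm_residues n \<alpha> \<union> half n x) (pm_residues n \<beta> \<union> half n y) (residues_of n \<gamma>))"
  have pos: "n > 0" if "admissible \<alpha> \<beta> \<gamma> n" for n
  proof -
    have "\<gamma> ! 0 \<in> set \<gamma>" using assms(6) by (intro nth_mem) linarith
    then have "\<gamma> ! 0 < n" using that unfolding admissible_def by blast
    then show ?thesis by simp
  qed
  have count: "of_int (int n * int (?\<tau> x y n)) =
      of_int s * (\<Prod>j = 1..<n. ev (if even j then p else p' x y) (zeta n j))"
    if "admissible \<alpha> \<beta> \<gamma> n" "x \<or> y \<longrightarrow> even n" for n x y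
    unfolding p_def p'_def assms(14)
    by (rule spanning_tree_count_symbol[OF pos[OF that(1)] \<alpha> assms(2) _ \<beta> assms(4) _ \<gamma> _ that(2) pa(1) pb(1) pc(1)])
      (use that(1) in \<open>auto simp: admissible_def\<close>)
  have form1: "\<exists>a. int (?\<tau> False False n) = int n * s * (if odd n then 1 else q1) * a\<^sup>2"
    if adm: "admissible \<alpha> \<beta> \<gamma> n" for n
  proof -
    have pp: "p' False False = p" by (simp add: p'_def p_def)
    have "of_int (int n * int (?\<tau> False False n)) = of_int s * (\<Prod>j = 1..<n. ev p (zeta n j))"
      using count[OF adm, of False False] by (simp only: pp if_cancel simp_thms)
    then show ?thesis using square_form_uniform[OF pos[OF adm] p2] unfolding q1 by auto
  qed
  have form2: "\<exists>a. 4 * int (?\<tau> x y n) =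
      int n * s * (if odd (n div 2) then squarefree_part (poly (p' x y) (- 2)) else q1) * a\<^sup>2"
    if "admissible \<alpha> \<beta> \<gamma> n \<and> even n" for n x y
    using square_form_alternating[OF pos _ p2 count[of n x y]] that unfolding q1 by auto
  have real1: "real t = real n * real_of_int s * real_of_int q * (real_of_int a)\<^sup>2"
    if "int t = int n * s * q * a\<^sup>2" for t n q a
  proof -
    have "real_of_int (int t) = real_of_int (int n * s * q * a\<^sup>2)" unfolding that ..
    then show ?thesis by simp
  qed
  have real2: "real t = 1 / 4 * real n * real_of_int s * real_of_int q * (real_of_int a)\<^sup>2"
    if "4 * int t = int n * s * q * a\<^sup>2" for t n q a
  proof -
    have "real_of_int (4 * int t) = real_of_int (int n * s * q * a\<^sup>2)" unfolding that ..
    then show ?thesis by simp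
  qed
  have \<Gamma>: "\<Gamma>\<^sub>1 \<alpha> \<beta> \<gamma> n = BC n (pm_residues n \<alpha> \<union> half n False) (pm_residues n \<beta> \<union> half n False) (residues_of n \<gamma>)"
    "\<Gamma>\<^sub>2 \<alpha> \<beta> \<gamma> n = BC n (pm_residues n \<alpha> \<union> half n True) (pm_residues n \<beta> \<union> half n False) (residues_of n \<gamma>)"
    "\<Gamma>\<^sub>3 \<alpha> \<beta> \<gamma> n = BC n (pm_residues n \<alpha> \<union> half n False) (pm_residues n \<beta> \<union> half n True) (residues_of n \<gamma>)"
    "\<Gamma>\<^sub>4 \<alpha> \<beta> \<gamma> n = BC n (pm_residues n \<alpha> \<union> half n True) (pm_residues n \<beta> \<union> half n True) (residues_of n \<gamma>)"
    for n unfolding \<Gamma>\<^sub>1_def \<Gamma>\<^sub>2_def \<Gamma>\<^sub>3_def \<Gamma>\<^sub>4_def half_def by simp_all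
  \<comment> \<open>One sequence serves as both \<open>a1\<close> and \<open>b1\<close>, since the
    parity of \<open>n\<close> selects the formula; the other three graphs are treated alike with
    the parity of \<open>n div 2\<close>.\<close>
  obtain a1 where a1: "\<And>n. admissible \<alpha> \<beta> \<gamma> n \<Longrightarrow>
      int (\<tau> (\<Gamma>\<^sub>1 \<alpha> \<beta> \<gamma> n)) = int n * s * (if odd n then 1 else q1) * (a1 n)\<^sup>2"
    using form1 unfolding \<Gamma> by metis
  obtain a2 where a2: "\<And>n. admissible \<alpha> \<beta> \<gamma> n \<and> even n \<Longrightarrow>
      4 * int (\<tau> (\<Gamma>\<^sub>2 \<alpha> \<beta> \<gamma> n)) = int n * s * (if odd (n div 2) then q2 else q1) * (a2 n)\<^sup>2"
    using form2[where x = True and y = False] unfolding \<Gamma> q by metis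
  obtain a3 where a3: "\<And>n. admissible \<alpha> \<beta> \<gamma> n \<and> even n \<Longrightarrow>
      4 * int (\<tau> (\<Gamma>\<^sub>3 \<alpha> \<beta> \<gamma> n)) = int n * s * (if odd (n div 2) then q3 else q1) * (a3 n)\<^sup>2"
    using form2[where x = False and y = True] unfolding \<Gamma> q by metis
  obtain a4 where a4: "\<And>n. admissible \<alpha> \<beta> \<gamma> n \<and> even n \<Longrightarrow>
      4 * int (\<tau> (\<Gamma>\<^sub>4 \<alpha> \<beta> \<gamma> n)) = int n * s * (if odd (n div 2) then q4 else q1) * (a4 n)\<^sup>2"
    using form2[where x = True and y = True] unfolding \<Gamma> q by metis
  show ?thesis
  proof (intro conjI)
    show "\<exists>(a1 :: nat \<Rightarrow> int) (b1 :: nat \<Rightarrow> int). \<forall>n :: nat. admissible \<alpha> \<beta> \<gamma> n \<longrightarrow>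
        (odd n \<longrightarrow> real (\<tau> (\<Gamma>\<^sub>1 \<alpha> \<beta> \<gamma> n)) =
            real n * real_of_int s * (real_of_int (a1 n))^2) \<and>
        (even n \<longrightarrow> real (\<tau> (\<Gamma>\<^sub>1 \<alpha> \<beta> \<gamma> n)) =
            real n * real_of_int s * real_of_int q1 * (real_of_int (b1 n))^2)"
      by (intro exI[of _ a1] allI impI conjI) (use real1[OF a1] in auto)
    show "\<exists>(a2 :: nat \<Rightarrow> int) (b2 :: nat \<Rightarrow> int). \<forall>n :: nat. admissible \<alpha> \<beta> \<gamma> n \<and> even n \<longrightarrow>
        (odd (n div 2) \<longrightarrow> real (\<tau> (\<Gamma>\<^sub>2 \<alpha> \<beta> \<gamma> n)) =
            1 / 4 * real n * real_of_int s * real_of_int q2 * (real_of_int (a2 n))^2) \<and>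
        (even (n div 2) \<longrightarrow> real (\<tau> (\<Gamma>\<^sub>2 \<alpha> \<beta> \<gamma> n)) =
            1 / 4 * real n * real_of_int s * real_of_int q1 * (real_of_int (b2 n))^2)"
      by (intro exI[of _ a2] allI impI conjI) (use real2[OF a2] in auto)
    show "\<exists>(a3 :: nat \<Rightarrow> int) (b3 :: nat \<Rightarrow> int). \<forall>n :: nat. admissible \<alpha> \<beta> \<gamma> n \<and> even n \<longrightarrow>
        (odd (n div 2) \<longrightarrow> real (\<tau> (\<Gamma>\<^sub>3 \<alpha> \<beta> \<gamma> n)) =
            1 / 4 * real n * real_of_int s * real_of_int q3 * (real_of_int (a3 n))^2) \<and>
        (even (n div 2) \<longrightarrow> real (\<tau> (\<Gamma>\<^sub>3 \<alpha> \<beta> \<gamma> n)) =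
            1 / 4 * real n * real_of_int s * real_of_int q1 * (real_of_int (b3 n))^2)"
      by (intro exI[of _ a3] allI impI conjI) (use real2[OF a3] in auto)
    show "\<exists>(a4 :: nat \<Rightarrow> int) (b4 :: nat \<Rightarrow> int). \<forall>n :: nat. admissible \<alpha> \<beta> \<gamma> n \<and> even n \<longrightarrow>
        (odd (n div 2) \<longrightarrow> real (\<tau> (\<Gamma>\<^sub>4 \<alpha> \<beta> \<gamma> n)) =
            1 / 4 * real n * real_of_int s * real_of_int q4 * (real_of_int (a4 n))^2) \<and>
        (even (n div 2) \<longrightarrow> real (\<tau> (\<Gamma>\<^sub>4 \<alpha> \<beta> \<gamma> n)) =
            1 / 4 * real n * real_of_int s * real_of_int q1 * (real_of_int (b4 n))^2)"
      by (intro exI[of _ a4] allI impI conjI) (use real2[OF a4] in auto)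
  qed
qed

end
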